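(* Let $G$ be a torsion-free group with neutral element $e$ and let $S$ be a nonzero nearly epsilon-strongly $G$-graded ring. Then $S$ is prime if and only if $S_e$ is $G$-prime.
   Context: Rings are associative but not necessarily unital; ideals are two-sided. For subsets $U,V$ of a ring, $UV$ denotes the set of finite sums of elements $uv$ with $u\in U$, $v\in V$. A ring $S$ is prime if $\{0\}$ is a proper ideal and for all ideals $A,B$ of $S$, $AB=\{0\}$ implies $A=\{0\}$ or $B=\{0\}$. A ring $S$ is $G$-graded if $S=\bigoplus_{x\in G}S_x$ as additive groups for given additive subgroups $S_x$, with $S_xS_y\subseteq S_{xy}$ for all $x,y\in G$. $S$ is nearly epsilon-strongly $G$-graded if for every $x\in G$ and every $s\in S_x$ there exist $\epsilon_x(s)\in S_xS_{x^{-1}}$ and $\epsilon_x'(s)\in S_{x^{-1}}S_x$ such that $\epsilon_x(s)s=s=s\epsilon_x'(s)$. An ideal $I$ of $S_e$ is $G$-invariant if $S_{x^{-1}} I S_x\subseteq I$ for every $x\in G$. The ring $S_e$ is $G$-prime if $\{0\}$ is a proper ideal of $S_e$ and for all $G$-invariant ideals $A,B$ of $S_e$, $AB=\{0\}$ implies $A=\{0\}$ or $B=\{0\}$. *)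

theory Defs
  imports "HOL-Algebra.Coset"
begin

text \<open>
  The ambient ring is a type of class \<^class>\<open>ring\<close>, which is associative but need not be
  unital or commutative; the ring locale of HOL-Algebra requires a unit.  Subrings such as the
  neutral component of a grading are subsets of this type, so ideals are relative to a subset.
\<close>

definition torsion_free_group :: "('g, 'm) monoid_scheme \<Rightarrow> bool" where
  "torsion_free_group G \<longleftrightarrow> group G \<and>
     (\<forall>x\<in>carrier G. \<forall>n::nat. n > 0 \<longrightarrow> x [^]\<^bsub>G\<^esub> n = \<one>\<^bsub>G\<^esub> \<longrightarrow> x = \<one>\<^bsub>G\<^esub>)"

definition add_subgroup :: "'a::ring set \<Rightarrow> bool" where
  "add_subgroup A \<longleftrightarrow> 0 \<in> A \<and> (\<forall>a\<in>A. \<forall>b\<in>A. a + b \<in> A) \<and> (\<forall>a\<in>A. - a \<in> A)"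

definition prod_sums :: "'a::ring set \<Rightarrow> 'a set \<Rightarrow> 'a set" where
  "prod_sums U V =
     {\<Sum>i<n. u i * v i | (n::nat) u v. \<forall>i<n. u i \<in> U \<and> v i \<in> V}"

definition ideal_of :: "'a::ring set \<Rightarrow> 'a set \<Rightarrow> bool" where
  "ideal_of I R \<longleftrightarrow> I \<subseteq> R \<and> add_subgroup I \<and>
     (\<forall>r\<in>R. \<forall>a\<in>I. r * a \<in> I \<and> a * r \<in> I)"

definition proper_ideal_of :: "'a::ring set \<Rightarrow> 'a set \<Rightarrow> bool" where
  "proper_ideal_of I R \<longleftrightarrow> ideal_of I R \<and> I \<noteq> R"

definition prime_ring :: "'a::ring set \<Rightarrow> bool" where
  "prime_ring R \<longleftrightarrow> proper_ideal_of {0} R \<and>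
     (\<forall>A B. ideal_of A R \<and> ideal_of B R \<and> prod_sums A B = {0} \<longrightarrow> A = {0} \<or> B = {0})"

text \<open>
  In the direct sum condition a family indexed by the carrier of \<open>G\<close> is represented by a total
  function that vanishes outside the carrier, so that uniqueness is meaningful.
\<close>

definition direct_sum_decomposition ::
    "('g, 'm) monoid_scheme \<Rightarrow> ('g \<Rightarrow> 'a::ring set) \<Rightarrow> bool" where
  "direct_sum_decomposition G S \<longleftrightarrow>
     (\<forall>x\<in>carrier G. add_subgroup (S x)) \<and>
     (\<forall>s. \<exists>!f. (\<forall>x\<in>carrier G. f x \<in> S x) \<and> (\<forall>x. x \<notin> carrier G \<longrightarrow> f x = 0) \<and>
        finite {x. f x \<noteq> 0} \<and> s = (\<Sum>x | f x \<noteq> 0. f x))"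

definition graded_ring :: "('g, 'm) monoid_scheme \<Rightarrow> ('g \<Rightarrow> 'a::ring set) \<Rightarrow> bool" where
  "graded_ring G S \<longleftrightarrow> direct_sum_decomposition G S \<and>
     (\<forall>x\<in>carrier G. \<forall>y\<in>carrier G. prod_sums (S x) (S y) \<subseteq> S (x \<otimes>\<^bsub>G\<^esub> y))"

definition nearly_epsilon_strongly_graded ::
    "('g, 'm) monoid_scheme \<Rightarrow> ('g \<Rightarrow> 'a::ring set) \<Rightarrow> bool" where
  "nearly_epsilon_strongly_graded G S \<longleftrightarrow> graded_ring G S \<and>
     (\<forall>x\<in>carrier G. \<forall>s\<in>S x.
        \<exists>\<epsilon>\<in>prod_sums (S x) (S (inv\<^bsub>G\<^esub> x)). \<exists>\<epsilon>'\<in>prod_sums (S (inv\<^bsub>G\<^esub> x)) (S x).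
          \<epsilon> * s = s \<and> s = s * \<epsilon>')"

definition G_invariant ::
    "('g, 'm) monoid_scheme \<Rightarrow> ('g \<Rightarrow> 'a::ring set) \<Rightarrow> 'a set \<Rightarrow> bool" where
  "G_invariant G S I \<longleftrightarrow>
     (\<forall>x\<in>carrier G. prod_sums (prod_sums (S (inv\<^bsub>G\<^esub> x)) I) (S x) \<subseteq> I)"

definition G_prime :: "('g, 'm) monoid_scheme \<Rightarrow> ('g \<Rightarrow> 'a::ring set) \<Rightarrow> bool" where
  "G_prime G S \<longleftrightarrow> proper_ideal_of {0} (S \<one>\<^bsub>G\<^esub>) \<and>
     (\<forall>A B. ideal_of A (S \<one>\<^bsub>G\<^esub>) \<and> G_invariant G S A \<and>
            ideal_of B (S \<one>\<^bsub>G\<^esub>) \<and> G_invariant G S B \<and>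
            prod_sums A B = {0} \<longrightarrow> A = {0} \<or> B = {0})"

end

theory Submission
  imports Defs "HOL-Algebra.FiniteProduct"
begin

text \<open>For nonzero homogeneous elements \<open>a\<close>, \<open>b\<close> let \<open>linked a b\<close> be the set of degrees \<open>h\<close> with \<open>a S h b \<noteq> 0\<close>;
  it is nonempty if the neutral component is G-prime. Suppose that \<open>A B = 0\<close> for nonzero ideals. The
  argument is Passman's Delta-method: one passes to a subgroup \<open>H\<close> and an element \<open>\<beta>\<close> of \<open>B\<close>
  supported in \<open>H\<close> whose components are linked only through \<open>H\<close>, such that as few quotients as possible of
  elements of the support of \<open>\<beta>\<close> have infinitely many conjugates under \<open>H\<close>. If links were covered by
  finitely many cosets of centralizers of such quotients, then a stabilizer argument would produce
  a smaller \<open>H\<close>. Hence, up to such cosets, only the part of \<open>\<beta>\<close> over the FC-centre of \<open>H\<close> matters.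
  This centre is torsion-free, hence abelian by Schur's theorem and orderable, and leading terms
  give a contradiction.\<close>

section \<open>Torsion-free groups\<close>

text \<open>In a group ring over a domain every \<open>linked a b\<close> is the whole group, and
  the Delta-method rests on Neumann's lemma: finitely many cosets of subgroups of infinite index do
  not cover a group. Here \<open>a * s * b\<close> can vanish for all \<open>s\<close> of a given
  degree, so coverings concern the sets \<open>linked a b\<close>, of which only nonemptiness is
  known, and that lemma does not apply. Minimal coverings take its place: multiplication by
  homogeneous elements translates links, so a covering by as few cosets as possible is permuted by
  such a translation, or else can be shortened. The two factors are treated asymmetrically. Only
  \<open>\<beta>\<close> is normalized; an element of \<open>A\<close> is merely multiplied on the
  right until all its components are left multiples of a chosen homogeneous element, which bounds
  their links. Local units of homogeneous elements replace the missing identity.\<close>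

lemma (in group) finite_index_center_torsion_free_comm:
  fixes f :: "'a \<Rightarrow> 'c"
  assumes tf: "\<And>x n. x \<in> carrier G \<Longrightarrow> (n::nat) > 0 \<Longrightarrow> x [^] n = \<one> \<Longrightarrow> x = \<one>"
    and Z: "Z = {z \<in> carrier G. \<forall>g\<in>carrier G. z \<otimes> g = g \<otimes> z}"
    and fin: "finite (f ` carrier G)"
    and f: "\<And>g h. g \<in> carrier G \<Longrightarrow> h \<in> carrier G \<Longrightarrow> f g = f h \<longleftrightarrow> inv g \<otimes> h \<in> Z"
    and gh: "g \<in> carrier G" "h \<in> carrier G"
  shows "g \<otimes> h = h \<otimes> g"
proof -
  define rep where "rep g = (SOME t. t \<in> carrier G \<and> f t = f g)" for g
  have rep: "rep g \<in> carrier G \<and> f (rep g) = f g" if "g \<in> carrier G" for g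
    unfolding rep_def by (rule someI[of _ g]) (use that in auto)
  have rep_cong: "rep g = rep h" if "f g = f h" for g h
    using that by (simp add: rep_def)
  have f_left: "f (k \<otimes> g) = f (k \<otimes> h) \<longleftrightarrow> f g = f h"
    if "g \<in> carrier G" "h \<in> carrier G" "k \<in> carrier G" for g h k
    using that by (simp add: f inv_mult_group m_assoc inv_solve_left')
      (metis inv_closed l_inv l_one m_assoc)
  define R where "R = rep ` carrier G"
  have R: "R \<subseteq> carrier G" using rep by (auto simp: R_def)
  have finR: "finite R"
  proof (rule finite_imageD)
    show "finite (f ` R)" using fin R by (meson finite_subset image_mono)
    show "inj_on f R"
      unfolding inj_on_def R_def using rep rep_cong by (metis (no_types, lifting) imageE)
  qed
  have R_fix: "rep t = t" if t: "t \<in> R" for t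
  proof -
    obtain g where g: "g \<in> carrier G" "t = rep g" using t by (auto simp: R_def)
    then show ?thesis using rep_cong[of t g] rep[of g] by simp
  qed
  let ?C = "G\<lparr>carrier := Z\<rparr>"
  have subZ: "subgroup Z G"
  proof (rule subgroupI)
    show "Z \<subseteq> carrier G" by (auto simp: Z)
    have "\<one> \<in> Z" by (simp add: Z)
    then show "Z \<noteq> {}" by blast
  next
    fix a assume a: "a \<in> Z"
    have ac: "a \<in> carrier G" using a by (simp add: Z)
    have "inv a \<otimes> g = g \<otimes> inv a" if g: "g \<in> carrier G" for g
    proof -
      have "a \<otimes> inv g = inv g \<otimes> a" using a g by (simp add: Z)
      then have "inv (a \<otimes> inv g) = inv (inv g \<otimes> a)" by (rule arg_cong)
      then show ?thesis using ac g by (simp add: inv_mult_group)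
    qed
    then show "inv a \<in> Z" using ac unfolding Z by blast
  next
    fix a b assume ab: "a \<in> Z" "b \<in> Z"
    have abc: "a \<in> carrier G" "b \<in> carrier G" using ab by (auto simp: Z)
    have "a \<otimes> b \<otimes> g = g \<otimes> (a \<otimes> b)" if g: "g \<in> carrier G" for g
    proof -
      have "a \<otimes> b \<otimes> g = a \<otimes> (b \<otimes> g)" using abc g by (simp add: m_assoc)
      also have "b \<otimes> g = g \<otimes> b" using ab g by (simp add: Z)
      also have "a \<otimes> (g \<otimes> b) = a \<otimes> g \<otimes> b" using abc g by (simp add: m_assoc)
      also have "a \<otimes> g = g \<otimes> a" using ab g by (simp add: Z)
      finally show ?thesis using abc g by (simp add: m_assoc)
    qed
    then show "a \<otimes> b \<in> Z" using abc unfolding Z by blast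
  qed
  interpret C: comm_group ?C
  proof (rule group.group_comm_groupI)
    show "group ?C" using subZ by (simp add: subgroup_imp_group)
  next
    fix x y assume "x \<in> carrier ?C" "y \<in> carrier ?C"
    then have "x \<in> Z" "y \<in> carrier G" using subgroup.subset[OF subZ] by auto
    then show "x \<otimes>\<^bsub>?C\<^esub> y = y \<otimes>\<^bsub>?C\<^esub> x" by (simp add: Z)
  qed
  \<comment> \<open>Transfer into the centre: \<open>V\<close> is a homomorphism, and it raises a
    central element to the power \<open>card R\<close>, the index of \<open>Z\<close>. Every element
    has a positive power in \<open>Z\<close>, so torsion-freeness gives \<open>V\<close> a trivial
    kernel; as \<open>Z\<close> is abelian, commutators are trivial.\<close>
  define \<phi> where "\<phi> g t = inv (rep (g \<otimes> t)) \<otimes> (g \<otimes> t)" for g t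
  have \<phi>: "\<phi> g t \<in> Z" if "g \<in> carrier G" "t \<in> carrier G" for g t
    unfolding \<phi>_def using that rep[of "g \<otimes> t"] f[of "rep (g \<otimes> t)" "g \<otimes> t"] by blast
  define V where "V g = finprod ?C (\<phi> g) R" for g
  have V_closed: "V g \<in> Z" if "g \<in> carrier G" for g
  proof -
    have "\<phi> g \<in> R \<rightarrow> carrier ?C" using \<phi> that R by fastforce
    then show ?thesis using C.finprod_closed[of "\<phi> g" R] by (simp add: V_def)
  qed
  have V_mult: "V (g \<otimes> h) = V g \<otimes> V h" if gh: "g \<in> carrier G" "h \<in> carrier G" for g h
  proof -
    \<comment> \<open>\<open>\<tau>\<close> is the permutation of the representatives induced by
      left multiplication with \<open>h\<close>; reindexing by it makes the transfer
      multiplicative.\<close>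
    define \<tau> where "\<tau> t = rep (h \<otimes> t)" for t
    have \<tau>R: "\<tau> ` R \<subseteq> R" using R gh by (auto simp: R_def \<tau>_def)
    have inj: "inj_on \<tau> R"
    proof (rule inj_onI)
      fix s t assume st: "s \<in> R" "t \<in> R" "\<tau> s = \<tau> t"
      then have "f (h \<otimes> s) = f (h \<otimes> t)"
        using rep R gh by (metis \<tau>_def m_closed subsetD)
      then have "f s = f t" using f_left st R gh by blast
      then show "s = t" using rep_cong R_fix st by metis
    qed
    have surj: "\<tau> ` R = R" using endo_inj_surj[OF finR \<tau>R inj] .
    have split: "\<phi> (g \<otimes> h) t = \<phi> g (\<tau> t) \<otimes>\<^bsub>?C\<^esub> \<phi> h t" if t: "t \<in> R" for t
    proof -
      have tc: "t \<in> carrier G" using t R by blast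
      have rc: "rep (h \<otimes> t) \<in> carrier G" "f (rep (h \<otimes> t)) = f (h \<otimes> t)"
        using rep[of "h \<otimes> t"] gh tc by auto
      have "f (g \<otimes> rep (h \<otimes> t)) = f (g \<otimes> (h \<otimes> t))"
        using f_left[of "rep (h \<otimes> t)" "h \<otimes> t" g] rc gh tc by simp
      then have "rep (g \<otimes> rep (h \<otimes> t)) = rep (g \<otimes> h \<otimes> t)"
        using rep_cong[of "g \<otimes> rep (h \<otimes> t)" "g \<otimes> (h \<otimes> t)"] gh tc by (simp add: m_assoc)
      moreover have "rep (g \<otimes> h \<otimes> t) \<in> carrier G"
        using rep[of "g \<otimes> h \<otimes> t"] gh tc by auto
      moreover have "rep (h \<otimes> t) \<otimes> (inv rep (h \<otimes> t) \<otimes> (h \<otimes> t)) = h \<otimes> t"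
        using gh tc rc by (simp add: m_assoc[symmetric])
      ultimately show ?thesis using gh tc rc
        by (simp add: \<phi>_def \<tau>_def m_assoc)
    qed
    have "V (g \<otimes> h) = finprod ?C (\<lambda>t. \<phi> g (\<tau> t) \<otimes>\<^bsub>?C\<^esub> \<phi> h t) R"
      unfolding V_def
    proof (rule C.finprod_cong'[OF refl])
      show "(\<lambda>t. \<phi> g (\<tau> t) \<otimes>\<^bsub>?C\<^esub> \<phi> h t) \<in> R \<rightarrow> carrier ?C"
        using \<phi> gh R \<tau>R by (fastforce intro!: subgroup.m_closed[OF subZ])
    qed (use split in simp)
    also have "\<dots> = finprod ?C (\<lambda>t. \<phi> g (\<tau> t)) R \<otimes>\<^bsub>?C\<^esub> V h"
      unfolding V_def by (rule C.finprod_multf) (use \<phi> gh R \<tau>R in fastforce)+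
    also have "finprod ?C (\<lambda>t. \<phi> g (\<tau> t)) R = finprod ?C (\<phi> g) (\<tau> ` R)"
      by (rule C.finprod_reindex[symmetric]) (use \<phi> gh R \<tau>R inj in fastforce)+
    finally show ?thesis using surj by (simp add: V_def)
  qed
  have V_central: "V z = z [^] card R" if z: "z \<in> Z" for z
  proof -
    have "V z = finprod ?C (\<lambda>_. z) R"
      unfolding V_def
    proof (rule C.finprod_cong'[OF refl])
      fix t assume t: "t \<in> R"
      then have tc: "t \<in> carrier G" using R by blast
      have zc: "z \<in> carrier G" "z \<otimes> t = t \<otimes> z" using z tc by (auto simp: Z)
      have "f t = f (t \<otimes> z)" using f[of t "t \<otimes> z"] tc zc z by (simp add: m_assoc[symmetric])
      then have "rep (t \<otimes> z) = t" using rep_cong R_fix t by metis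
      then show "\<phi> z t = z" using zc tc by (simp add: \<phi>_def m_assoc[symmetric])
    qed (use z in auto)
    also have "\<dots> = z [^]\<^bsub>?C\<^esub> card R" using C.finprod_const[of z R] z by simp
    finally show ?thesis by (simp add: nat_pow_def)
  qed
  have V_pow: "V (u [^] (Suc m)) = V u [^] (Suc m)" if u: "u \<in> carrier G" for u m
  proof (induction m)
    case 0
    have "V u \<in> carrier G" using V_closed u by (auto simp: Z)
    then show ?case using u by simp
  next
    case (Suc m)
    have "V (u [^] Suc (Suc m)) = V (u [^] Suc m \<otimes> u)" by simp
    also have "\<dots> = V (u [^] Suc m) \<otimes> V u" using V_mult u by simp
    finally show ?case using Suc by simp
  qed
  have cardR: "card R > 0" using finR by (auto simp: card_gt_0_iff R_def)
  have V_inj: "u = \<one>" if u: "u \<in> carrier G" "V u = \<one>" for u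
  proof -
    \<comment> \<open>Two powers of \<open>u\<close> share a coset of \<open>Z\<close>, so a
      positive power of \<open>u\<close> is central.\<close>
    have "\<not> inj (\<lambda>n::nat. f (u [^] n))"
    proof
      assume "inj (\<lambda>n::nat. f (u [^] n))"
      then have "infinite (range (\<lambda>n::nat. f (u [^] n)))" using finite_imageD by fastforce
      moreover have "range (\<lambda>n::nat. f (u [^] n)) \<subseteq> f ` carrier G" using u by auto
      ultimately show False using fin finite_subset by blast
    qed
    then obtain i j :: nat where "i < j" "f (u [^] i) = f (u [^] j)"
      by (metis (no_types, lifting) injI linorder_neqE_nat)
    moreover define m where "m = j - i - 1"
    ultimately have j: "j = i + Suc m" "f (u [^] i) = f (u [^] j)" by auto
    then have "inv (u [^] i) \<otimes> (u [^] i \<otimes> u [^] Suc m) \<in> Z"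
      using f[of "u [^] i" "u [^] j"] u nat_pow_mult[of u i "Suc m"] by simp
    then have mZ: "u [^] Suc m \<in> Z" using u by (metis inv_closed l_inv l_one m_assoc nat_pow_closed)
    then have "(u [^] Suc m) [^] card R = V u [^] Suc m" using V_central V_pow u by metis
    then have "u [^] (Suc m * card R) = \<one>" using u nat_pow_one by (metis nat_pow_pow)
    then show ?thesis using tf[of u "Suc m * card R"] u cardR by simp
  qed
  define u where "u = g \<otimes> h \<otimes> inv (h \<otimes> g)"
  have uc: "u \<in> carrier G" using gh by (simp add: u_def)
  have uhg: "u \<otimes> (h \<otimes> g) = g \<otimes> h" using gh by (simp add: u_def m_assoc)
  have Vc: "V g \<in> carrier G" "V h \<in> carrier G" "V u \<in> carrier G"
    using V_closed gh uc by (auto simp: Z)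
  have "V u \<otimes> (V h \<otimes> V g) = V (g \<otimes> h)" using V_mult[of u "h \<otimes> g"] V_mult gh uc uhg by simp
  also have "\<dots> = V g \<otimes> V h" using V_mult gh by simp
  also have "\<dots> = V h \<otimes> V g" using V_closed[OF gh(1)] Vc unfolding Z by blast
  finally have "V u = \<one>" using Vc by (simp add: r_cancel_one)
  then have "u = \<one>" using V_inj uc by blast
  then show ?thesis using uhg gh by simp
qed

section \<open>Orders on torsion-free abelian groups\<close>

lemma (in comm_group) torsion_free_positive_cone:
  assumes tf: "\<And>x n. x \<in> carrier G \<Longrightarrow> (n::nat) > 0 \<Longrightarrow> x [^] n = \<one> \<Longrightarrow> x = \<one>"
  obtains P where "P \<subseteq> carrier G" "\<one> \<in> P" "\<And>x y. x \<in> P \<Longrightarrow> y \<in> P \<Longrightarrow> x \<otimes> y \<in> P"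
    "\<And>x. x \<in> P \<Longrightarrow> inv x \<in> P \<Longrightarrow> x = \<one>" "\<And>x. x \<in> carrier G \<Longrightarrow> x \<in> P \<or> inv x \<in> P"
proof -
  define \<C> where "\<C> = {P. P \<subseteq> carrier G \<and> \<one> \<in> P \<and> (\<forall>x\<in>P. \<forall>y\<in>P. x \<otimes> y \<in> P) \<and>
     (\<forall>x\<in>P. inv x \<in> P \<longrightarrow> x = \<one>)}"
  have "\<exists>M\<in>\<C>. \<forall>X\<in>\<C>. M \<subseteq> X \<longrightarrow> X = M"
  proof (rule subset_Zorn_nonempty)
    have "{\<one>} \<in> \<C>" by (auto simp: \<C>_def)
    then show "\<C> \<noteq> {}" by blast
  next
    fix C assume C: "C \<noteq> {}" "subset.chain \<C> C"
    then have sub: "C \<subseteq> \<C>" by (simp add: subset.chain_def)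
    have two: "\<exists>P\<in>C. x \<in> P \<and> y \<in> P" if xy: "x \<in> \<Union>C" "y \<in> \<Union>C" for x y
    proof -
      obtain P Q where PQ: "P \<in> C" "x \<in> P" "Q \<in> C" "y \<in> Q" using xy by blast
      then have "P \<subseteq> Q \<or> Q \<subseteq> P" using C(2) by (auto simp: subset_chain_def)
      then show ?thesis using PQ by blast
    qed
    have "x \<otimes> y \<in> \<Union>C" if "x \<in> \<Union>C" "y \<in> \<Union>C" for x y
      using two[OF that] sub by (auto simp: \<C>_def)
    moreover have "x = \<one>" if "x \<in> \<Union>C" "inv x \<in> \<Union>C" for x
      using two[OF that] sub by (auto simp: \<C>_def)
    moreover have "\<one> \<in> \<Union>C" "\<Union>C \<subseteq> carrier G" using sub C(1) by (auto simp: \<C>_def)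
    ultimately show "\<Union>C \<in> \<C>" unfolding \<C>_def by blast
  qed
  then obtain M where M: "M \<in> \<C>" and max: "\<And>X. X \<in> \<C> \<Longrightarrow> M \<subseteq> X \<Longrightarrow> X = M" by blast
  have Mc: "M \<subseteq> carrier G" "\<one> \<in> M" "\<And>x y. x \<in> M \<Longrightarrow> y \<in> M \<Longrightarrow> x \<otimes> y \<in> M"
    "\<And>x. x \<in> M \<Longrightarrow> inv x \<in> M \<Longrightarrow> x = \<one>" using M unfolding \<C>_def by blast+
  have Mpow: "x [^] n \<in> M" if "x \<in> M" for x and n :: nat
    by (induction n) (use that Mc(1-3) in auto)
  \<comment> \<open>Adjoining \<open>x\<close> to the maximal \<open>M\<close> must produce some
    \<open>u\<close> other than \<open>\<one>\<close> together with its inverse. Multiplying their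
    two expressions turns a power of \<open>inv x\<close> into an element of \<open>M\<close>; the
    exponent is positive because otherwise \<open>u\<close> and \<open>inv u\<close> would both lie
    in \<open>M\<close>.\<close>
  have neg_pow: "\<exists>k::nat. k > 0 \<and> inv x [^] k \<in> M" if x: "x \<in> carrier G" "x \<notin> M" for x
  proof -
    define X where "X = {p \<otimes> x [^] n | p (n::nat). p \<in> M}"
    have "p \<in> X" if "p \<in> M" for p
      unfolding X_def using that Mc(1) by (intro CollectI exI[of _ p] exI[of _ "0::nat"]) auto
    then have MX: "M \<subseteq> X" by blast
    have "x \<in> X" unfolding X_def using x Mc(2)
      by (intro CollectI exI[of _ \<one>] exI[of _ "1::nat"]) auto
    then have "X \<notin> \<C>" using max MX x by blast
    moreover have "X \<subseteq> carrier G" using Mc(1) x by (auto simp: X_def)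
    moreover have "a \<otimes> b \<in> X" if ab: "a \<in> X" "b \<in> X" for a b
    proof -
      obtain p q and n m :: nat where "a = p \<otimes> x [^] n" "p \<in> M" "b = q \<otimes> x [^] m" "q \<in> M"
        using ab by (auto simp: X_def)
      moreover from this have "a \<otimes> b = (p \<otimes> q) \<otimes> x [^] (n + m)"
        using Mc(1) x by (auto simp: nat_pow_mult[symmetric] m_ac subset_iff)
      ultimately show ?thesis using Mc(3) by (auto simp: X_def)
    qed
    ultimately obtain u where u: "u \<in> X" "inv u \<in> X" "u \<noteq> \<one>"
      using MX Mc(2) by (auto simp: \<C>_def)
    then obtain p q and n m :: nat where
      pq: "u = p \<otimes> x [^] n" "p \<in> M" "inv u = q \<otimes> x [^] m" "q \<in> M"
      by (auto simp: X_def)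
    have pqc: "p \<in> carrier G" "q \<in> carrier G" using pq Mc(1) by auto
    have "n + m > 0"
    proof (rule ccontr)
      assume "\<not> n + m > 0"
      then have "u = p" "inv u = q" using pq pqc by auto
      then show False using Mc(4) pq u by blast
    qed
    moreover have "u \<in> carrier G" using pq(1) pqc x by simp
    then have "u \<otimes> inv u = \<one>" by simp
    then have "(p \<otimes> q) \<otimes> x [^] (n + m) = \<one>"
      unfolding pq(3) unfolding pq(1) using pqc x by (simp add: nat_pow_mult[symmetric] m_ac)
    then have "inv x [^] (n + m) = p \<otimes> q"
      using pqc x by (metis inv_equality m_closed nat_pow_closed nat_pow_inv)
    ultimately show ?thesis using Mc(3) pq by metis
  qed
  have "x \<in> M \<or> inv x \<in> M" if x: "x \<in> carrier G" for x
  proof (rule ccontr)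
    assume "\<not> (x \<in> M \<or> inv x \<in> M)"
    then obtain k l :: nat where kl: "k > 0" "inv x [^] k \<in> M" "l > 0" "x [^] l \<in> M"
      using neg_pow[of x] neg_pow[of "inv x"] x by auto
    have "(x [^] l) [^] k \<in> M" "(inv x [^] k) [^] l \<in> M" using kl Mpow by auto
    then have "x [^] (l * k) \<in> M" "inv (x [^] (l * k)) \<in> M"
      using x by (auto simp: nat_pow_pow nat_pow_inv mult.commute)
    then have "x [^] (l * k) = \<one>" using Mc(4) by blast
    then have "x = \<one>" using tf[of x "l * k"] x kl by simp
    then show False using \<open>\<not> _\<close> Mc(2) by blast
  qed
  with that[OF Mc] show thesis by blast
qed

section \<open>Conjugation and elements with finitely many conjugates\<close>

context group
begin

definition conjugate :: "'a \<Rightarrow> 'a \<Rightarrow> 'a" where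
  "conjugate h x = h \<otimes> x \<otimes> inv h"

text \<open>The elements range over the whole group and not only over \<open>H\<close>: later a
  quotient \<open>w\<close> has finitely many conjugates under a subgroup that need not contain it.
  The FC-centre of \<open>H\<close> is \<open>H \<inter> fin_conj H\<close>.\<close>

definition fin_conj :: "'a set \<Rightarrow> 'a set" where
  "fin_conj H = {x \<in> carrier G. finite ((\<lambda>h. conjugate h x) ` H)}"

lemma conjugate_closed [simp]:
  "h \<in> carrier G \<Longrightarrow> x \<in> carrier G \<Longrightarrow> conjugate h x \<in> carrier G"
  by (simp add: conjugate_def)

lemma conjugate_mult:
  assumes "h \<in> carrier G" "x \<in> carrier G" "y \<in> carrier G"
  shows "conjugate h (x \<otimes> y) = conjugate h x \<otimes> conjugate h y"
proof -
  have "inv h \<otimes> (h \<otimes> (y \<otimes> inv h)) = y \<otimes> inv h" using assms by (simp add: m_assoc[symmetric])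
  then show ?thesis using assms by (simp add: conjugate_def m_assoc)
qed

lemma conjugate_inv:
  "h \<in> carrier G \<Longrightarrow> x \<in> carrier G \<Longrightarrow> conjugate h (inv x) = inv (conjugate h x)"
  by (simp add: conjugate_def inv_mult_group m_assoc)

lemma conjugate_conjugate:
  "g \<in> carrier G \<Longrightarrow> h \<in> carrier G \<Longrightarrow> x \<in> carrier G \<Longrightarrow>
    conjugate g (conjugate h x) = conjugate (g \<otimes> h) x"
  by (simp add: conjugate_def inv_mult_group m_assoc)

lemma conjugate_one [simp]: "x \<in> carrier G \<Longrightarrow> conjugate \<one> x = x"
  by (simp add: conjugate_def)

lemma conjugate_inv_conjugate [simp]:
  assumes "h \<in> carrier G" "x \<in> carrier G"
  shows "conjugate (inv h) (conjugate h x) = x" "conjugate h (conjugate (inv h) x) = x"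
  using assms by (simp_all add: conjugate_conjugate)

lemma conjugate_inj:
  assumes "conjugate h x = conjugate h y" "h \<in> carrier G" "x \<in> carrier G" "y \<in> carrier G"
  shows "x = y"
  using assms conjugate_inv_conjugate(1) by metis

lemma conjugate_eq_iff_commute:
  assumes "g \<in> carrier G" "h \<in> carrier G" "x \<in> carrier G"
  shows "conjugate g x = conjugate h x \<longleftrightarrow> (inv g \<otimes> h) \<otimes> x = x \<otimes> (inv g \<otimes> h)"
proof -
  have "conjugate g x = conjugate h x \<longleftrightarrow> x = conjugate (inv g \<otimes> h) x"
    using assms by (metis conjugate_conjugate conjugate_inv_conjugate conjugate_closed inv_closed)
  also have "\<dots> \<longleftrightarrow> (inv g \<otimes> h) \<otimes> x = x \<otimes> (inv g \<otimes> h)"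
    unfolding conjugate_def using assms
    by (metis inv_closed inv_solve_right m_closed)
  finally show ?thesis .
qed

lemma fin_conj_closed: "fin_conj H \<subseteq> carrier G"
  by (auto simp: fin_conj_def)

lemma fin_conj_anti_mono: "H' \<subseteq> H \<Longrightarrow> fin_conj H \<subseteq> fin_conj H'"
  unfolding fin_conj_def by (auto intro: finite_subset[OF image_mono])

lemma fin_conj_mult:
  assumes "H \<subseteq> carrier G" "x \<in> fin_conj H" "y \<in> fin_conj H"
  shows "x \<otimes> y \<in> fin_conj H"
proof -
  have c: "x \<in> carrier G" "y \<in> carrier G" using assms fin_conj_closed by auto
  have "(\<lambda>h. conjugate h (x \<otimes> y)) ` H \<subseteq>
      (\<lambda>(a, b). a \<otimes> b) ` ((\<lambda>h. conjugate h x) ` H \<times> (\<lambda>h. conjugate h y) ` H)"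
    using assms(1) c by (force simp: conjugate_mult)
  from finite_subset[OF this] show ?thesis using assms c unfolding fin_conj_def by simp
qed

lemma fin_conj_inv:
  assumes "H \<subseteq> carrier G" "x \<in> fin_conj H"
  shows "inv x \<in> fin_conj H"
proof -
  have c: "x \<in> carrier G" using assms fin_conj_closed by auto
  have "(\<lambda>h. conjugate h (inv x)) ` H \<subseteq> m_inv G ` (\<lambda>h. conjugate h x) ` H"
    using assms(1) c by (force simp: conjugate_inv)
  from finite_subset[OF this] show ?thesis using assms c unfolding fin_conj_def by simp
qed

lemma fin_conj_one: "H \<subseteq> carrier G \<Longrightarrow> \<one> \<in> fin_conj H"
proof -
  assume "H \<subseteq> carrier G"
  then have "(\<lambda>h. conjugate h \<one>) ` H \<subseteq> {\<one>}" by (auto simp: conjugate_def)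
  then show ?thesis unfolding fin_conj_def by (auto intro: finite_subset)
qed

lemma fin_conj_conjugate:
  assumes H: "subgroup H G" and h: "h \<in> H" and x: "x \<in> fin_conj H"
  shows "conjugate h x \<in> fin_conj H"
proof -
  have c: "x \<in> carrier G" "H \<subseteq> carrier G" using x fin_conj_closed subgroup.subset[OF H] by auto
  have "(\<lambda>g. conjugate g (conjugate h x)) ` H \<subseteq> (\<lambda>g. conjugate g x) ` H"
  proof
    fix z assume "z \<in> (\<lambda>g. conjugate g (conjugate h x)) ` H"
    then obtain g where "g \<in> H" "z = conjugate (g \<otimes> h) x"
      using c h by (auto simp: conjugate_conjugate subset_iff)
    then show "z \<in> (\<lambda>g. conjugate g x) ` H" using subgroup.m_closed[OF H _ h] by blast
  qed
  then show ?thesis using x c h unfolding fin_conj_def by (auto intro: finite_subset)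
qed

lemma subgroup_fin_conj:
  assumes "subgroup H G"
  shows "subgroup (H \<inter> fin_conj H) G"
  using assms fin_conj_mult[OF subgroup.subset[OF assms]] fin_conj_inv[OF subgroup.subset[OF assms]]
    fin_conj_one[OF subgroup.subset[OF assms]] subgroup.subset[OF assms]
  by (intro subgroupI) (auto intro: subgroup.m_closed subgroup.m_inv_closed subgroup.one_closed)

text \<open>Schur's theorem applies to the elements of \<open>H\<close> that commute with the common centralizer of
  \<open>x\<close> and \<open>y\<close>: its centre has finite index.\<close>

lemma fin_conj_torsion_free_commute:
  assumes tf: "torsion_free_group G" and H: "subgroup H G"
    and x: "x \<in> H \<inter> fin_conj H" and y: "y \<in> H \<inter> fin_conj H"
  shows "x \<otimes> y = y \<otimes> x"
proof -
  have Hc: "H \<subseteq> carrier G" using subgroup.subset[OF H] .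
  have xy: "x \<in> carrier G" "y \<in> carrier G" using x y Hc by auto
  define C where "C = {z \<in> H. z \<otimes> x = x \<otimes> z \<and> z \<otimes> y = y \<otimes> z}"
  \<comment> \<open>Everything in \<open>K\<close> commutes with \<open>C\<close> by definition, and
    \<open>x\<close>, \<open>y\<close> lie in \<open>K\<close>. Hence \<open>K \<inter> C\<close> is
    exactly the centre of \<open>K\<close>, and its cosets are told apart by the conjugates of
    \<open>x\<close> and \<open>y\<close>.\<close>
  define K where "K = {g \<in> H. \<forall>z\<in>C. z \<otimes> g = g \<otimes> z}"
  have Cc: "C \<subseteq> carrier G" using Hc by (auto simp: C_def)
  have KH: "K \<subseteq> H" "K \<subseteq> carrier G" using Hc by (auto simp: K_def)
  have xyK: "x \<in> K" "y \<in> K" using x y by (auto simp: K_def C_def)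
  have comm_iff: "z \<otimes> g = g \<otimes> z \<longleftrightarrow> conjugate z g = g"
    if "z \<in> carrier G" "g \<in> carrier G" for z g
    using that unfolding conjugate_def by (metis inv_closed inv_solve_right m_closed)
  have K_iff: "g \<in> K \<longleftrightarrow> g \<in> H \<and> (\<forall>z\<in>C. conjugate z g = g)" for g
    using comm_iff Cc Hc unfolding K_def by blast
  have subK: "subgroup K G"
  proof (rule subgroupI)
    show "K \<subseteq> carrier G" "K \<noteq> {}" using KH xyK by auto
    show "inv a \<in> K" if "a \<in> K" for a
      using that Cc KH subgroup.m_inv_closed[OF H] by (auto simp: K_iff conjugate_inv subset_iff)
    show "a \<otimes> b \<in> K" if "a \<in> K" "b \<in> K" for a b
      using that Cc KH subgroup.m_closed[OF H] by (auto simp: K_iff conjugate_mult subset_iff)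
  qed
  let ?K = "G\<lparr>carrier := K\<rparr>"
  interpret K: group ?K using subK by (rule subgroup_imp_group)
  define Z where "Z = {z \<in> carrier ?K. \<forall>g\<in>carrier ?K. z \<otimes>\<^bsub>?K\<^esub> g = g \<otimes>\<^bsub>?K\<^esub> z}"
  define f where "f g = (conjugate g x, conjugate g y)" for g
  have "x \<otimes>\<^bsub>?K\<^esub> y = y \<otimes>\<^bsub>?K\<^esub> x"
  proof (rule K.finite_index_center_torsion_free_comm[of Z f])
    fix u and n :: nat assume "u \<in> carrier ?K" "0 < n" "u [^]\<^bsub>?K\<^esub> n = \<one>\<^bsub>?K\<^esub>"
    then have "u \<in> carrier G" "0 < n" "u [^] n = \<one>"
      using KH nat_pow_consistent[of u n K] by auto
    then show "u = \<one>\<^bsub>?K\<^esub>" using tf unfolding torsion_free_group_def by auto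
  next
    have "finite (((\<lambda>h. conjugate h x) ` H) \<times> ((\<lambda>h. conjugate h y) ` H))"
      using x y by (auto simp: fin_conj_def)
    moreover have "f ` carrier ?K \<subseteq> ((\<lambda>h. conjugate h x) ` H) \<times> ((\<lambda>h. conjugate h y) ` H)"
      using KH by (auto simp: f_def)
    ultimately show "finite (f ` carrier ?K)" by (rule rev_finite_subset)
  next
    fix g h assume "g \<in> carrier ?K" "h \<in> carrier ?K"
    then have gh: "g \<in> K" "h \<in> K" "g \<in> carrier G" "h \<in> carrier G" using KH by auto
    let ?k = "inv g \<otimes> h"
    have k: "?k \<in> K" "inv\<^bsub>?K\<^esub> g = inv g"
      using gh subK m_inv_consistent[OF subK] by (auto intro: subgroup.m_closed subgroup.m_inv_closed)
    have "f g = f h \<longleftrightarrow> ?k \<otimes> x = x \<otimes> ?k \<and> ?k \<otimes> y = y \<otimes> ?k"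
      using gh xy by (simp add: f_def conjugate_eq_iff_commute)
    also have "\<dots> \<longleftrightarrow> ?k \<in> C" using k KH by (auto simp: C_def)
    also have "\<dots> \<longleftrightarrow> (\<forall>u\<in>K. ?k \<otimes> u = u \<otimes> ?k)"
      using k KH xyK by (auto simp: C_def K_def)
    finally show "f g = f h \<longleftrightarrow> inv\<^bsub>?K\<^esub> g \<otimes>\<^bsub>?K\<^esub> h \<in> Z"
      using k by (simp add: Z_def)
  qed (use xyK in \<open>auto simp: Z_def\<close>)
  then show ?thesis by simp
qed

lemma subgroup_positive_cone:
  assumes tf: "torsion_free_group G" and N: "subgroup N G"
    and comm: "\<And>x y. x \<in> N \<Longrightarrow> y \<in> N \<Longrightarrow> x \<otimes> y = y \<otimes> x"
  obtains P where "P \<subseteq> N" "\<one> \<in> P" "\<And>x y. x \<in> P \<Longrightarrow> y \<in> P \<Longrightarrow> x \<otimes> y \<in> P"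
    "\<And>x. x \<in> P \<Longrightarrow> inv x \<in> P \<Longrightarrow> x = \<one>" "\<And>x. x \<in> N \<Longrightarrow> x \<in> P \<or> inv x \<in> P"
proof -
  let ?N = "G\<lparr>carrier := N\<rparr>"
  interpret N: comm_group ?N
    by (rule group.group_comm_groupI) (use N comm in \<open>auto simp: subgroup_imp_group\<close>)
  have inv_eq: "inv\<^bsub>?N\<^esub> x = inv x" if "x \<in> N" for x
    using m_inv_consistent[OF N] that by simp
  show thesis
  proof (rule N.torsion_free_positive_cone)
    fix x and n :: nat
    assume *: "x \<in> carrier ?N" "n > 0" "x [^]\<^bsub>?N\<^esub> n = \<one>\<^bsub>?N\<^esub>"
    then have "x [^] n = \<one>" using nat_pow_consistent[of x n N] by simp
    then show "x = \<one>\<^bsub>?N\<^esub>"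
      using tf * subgroup.subset[OF N] unfolding torsion_free_group_def by auto
  next
    fix P assume P: "P \<subseteq> carrier ?N" "\<one>\<^bsub>?N\<^esub> \<in> P"
      "\<And>x y. x \<in> P \<Longrightarrow> y \<in> P \<Longrightarrow> x \<otimes>\<^bsub>?N\<^esub> y \<in> P"
      "\<And>x. x \<in> P \<Longrightarrow> inv\<^bsub>?N\<^esub> x \<in> P \<Longrightarrow> x = \<one>\<^bsub>?N\<^esub>"
      "\<And>x. x \<in> carrier ?N \<Longrightarrow> x \<in> P \<or> inv\<^bsub>?N\<^esub> x \<in> P"
    show thesis
    proof (rule that[of P])
      show "x = \<one>" if x: "x \<in> P" "inv x \<in> P" for x
      proof -
        have "inv\<^bsub>?N\<^esub> x \<in> P" using x P(1) inv_eq[of x] by auto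
        then show ?thesis using P(4)[OF x(1)] by simp
      qed
      show "x \<in> P \<or> inv x \<in> P" if "x \<in> N" for x
        using P(5)[of x] that inv_eq[of x] by simp
      show "x \<otimes> y \<in> P" if "x \<in> P" "y \<in> P" for x y using P(3)[OF that] by simp
    qed (use P(1,2) in simp_all)
  qed
qed

text \<open>The relation \<open>inv u \<otimes> v \<in> P\<close> is a left-invariant partial order
  on the whole group. In the application it compares only elements of one left coset of the ordered
  subgroup, so a support has maximal elements but perhaps no greatest one.\<close>

lemma exists_maximal_for_cone:
  assumes X: "finite X" "X \<noteq> {}" "X \<subseteq> carrier G"
    and P: "P \<subseteq> carrier G" "\<And>x y. x \<in> P \<Longrightarrow> y \<in> P \<Longrightarrow> x \<otimes> y \<in> P"
      "\<And>x. x \<in> P \<Longrightarrow> inv x \<in> P \<Longrightarrow> x = \<one>"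
  obtains m where "m \<in> X" "\<And>x. x \<in> X \<Longrightarrow> inv m \<otimes> x \<in> P \<Longrightarrow> x = m"
proof -
  let ?R = "\<lambda>u v. u \<noteq> v \<and> inv u \<otimes> v \<in> P"
  have anti: "u = v" if uv: "u \<in> X" "v \<in> X" "inv u \<otimes> v \<in> P" "inv v \<otimes> u \<in> P" for u v
  proof -
    have c: "u \<in> carrier G" "v \<in> carrier G" using uv X by auto
    then have "inv (inv u \<otimes> v) = inv v \<otimes> u" by (simp add: inv_mult_group)
    then have "inv u \<otimes> v = \<one>" using P(3) uv by metis
    then show ?thesis using c by (metis inv_closed inv_equality inv_inv)
  qed
  have trans: "inv u \<otimes> w \<in> P"
    if uvw: "u \<in> X" "v \<in> X" "w \<in> X" "inv u \<otimes> v \<in> P" "inv v \<otimes> w \<in> P" for u v w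
  proof -
    have c: "u \<in> carrier G" "v \<in> carrier G" "w \<in> carrier G" using uvw X by auto
    have "v \<otimes> (inv v \<otimes> w) = w" using c by (simp add: m_assoc[symmetric])
    then have "(inv u \<otimes> v) \<otimes> (inv v \<otimes> w) = inv u \<otimes> w" using c by (simp add: m_assoc)
    then show ?thesis using P(2)[OF uvw(4,5)] by simp
  qed
  have "asymp_on X ?R" using anti by (intro asymp_onI) blast
  moreover have "transp_on X ?R" using anti trans by (intro transp_onI) blast
  ultimately obtain m where "m \<in> X" "\<forall>x\<in>X. x \<noteq> m \<longrightarrow> \<not> ?R m x"
    using Finite_Set.bex_max_element[OF X(1) _ _ X(2), of ?R] by blast
  then show thesis using that by blast
qed

section \<open>Small sets\<close>

text \<open>A subset \<open>T\<close> of the group is small if it is covered by finitely many left cosets of centralizers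
  of elements of \<open>Q\<close>; the coset of \<open>h\<close> modulo the centralizer of \<open>w\<close> is recorded by the conjugate of
  \<open>w\<close> under \<open>h\<close>.\<close>

definition small :: "'a set \<Rightarrow> 'a set \<Rightarrow> bool" where
  "small Q T \<longleftrightarrow> (\<exists>Z. finite Z \<and> (\<forall>h\<in>T. \<exists>w\<in>Q. conjugate h w \<in> Z))"

lemma small_mono: "small Q T' \<Longrightarrow> T \<subseteq> T' \<Longrightarrow> small Q T"
  unfolding small_def by (meson subsetD)

lemma small_Un: "small Q T \<Longrightarrow> small Q T' \<Longrightarrow> small Q (T \<union> T')"
proof -
  assume "small Q T" "small Q T'"
  then obtain Z Z' where "finite Z" "\<forall>h\<in>T. \<exists>w\<in>Q. conjugate h w \<in> Z"
    "finite Z'" "\<forall>h\<in>T'. \<exists>w\<in>Q. conjugate h w \<in> Z'" by (auto simp: small_def)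
  then have "finite (Z \<union> Z')" "\<forall>h\<in>T \<union> T'. \<exists>w\<in>Q. conjugate h w \<in> Z \<union> Z'" by auto
  then show ?thesis unfolding small_def by blast
qed

lemma conjugate_shift:
  "g \<in> carrier G \<Longrightarrow> h \<in> carrier G \<Longrightarrow> w \<in> carrier G \<Longrightarrow>
    conjugate h w = conjugate (inv g) (conjugate (g \<otimes> h) w)"
  by (simp add: conjugate_conjugate m_assoc[symmetric])

lemma small_shift:
  assumes "small Q T" "Q \<subseteq> carrier G" "g \<in> carrier G"
  shows "small Q {h \<in> carrier G. g \<otimes> h \<in> T}"
proof -
  obtain Z where Z: "finite Z" "\<forall>h\<in>T. \<exists>w\<in>Q. conjugate h w \<in> Z"
    using assms by (auto simp: small_def)
  have "\<exists>w\<in>Q. conjugate h w \<in> conjugate (inv g) ` Z" if h: "h \<in> carrier G" "g \<otimes> h \<in> T" for h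
  proof -
    obtain w where w: "w \<in> Q" "conjugate (g \<otimes> h) w \<in> Z" using Z h by blast
    then have "conjugate h w = conjugate (inv g) (conjugate (g \<otimes> h) w)"
      using conjugate_shift assms h by blast
    then show ?thesis using w by blast
  qed
  then show ?thesis using Z(1) unfolding small_def by blast
qed

text \<open>The base case when centralizers are added one at a time: over the empty set, not being
  small is nonemptiness.\<close>

lemma small_empty_iff: "small {} T \<longleftrightarrow> T = {}"
  by (auto simp: small_def)

lemma subgroup_conjugate_stabilizer:
  assumes Z: "Z \<subseteq> carrier G"
  shows "subgroup {g \<in> carrier G. conjugate g ` Z = Z} G"
proof (rule subgroupI)
  show "{g \<in> carrier G. conjugate g ` Z = Z} \<noteq> {}"
  proof -
    have "conjugate \<one> ` Z = Z" using Z by (auto simp: subset_iff image_iff)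
    then show ?thesis by blast
  qed
next
  fix g assume g: "g \<in> {g \<in> carrier G. conjugate g ` Z = Z}"
  then have "conjugate (inv g) ` Z = conjugate (inv g) ` conjugate g ` Z" by simp
  also have "\<dots> = (\<lambda>z. z) ` Z"
    unfolding image_image by (rule image_cong) (use g Z in auto)
  finally show "inv g \<in> {g \<in> carrier G. conjugate g ` Z = Z}" using g by simp
next
  fix g h assume gh: "g \<in> {g \<in> carrier G. conjugate g ` Z = Z}"
    "h \<in> {g \<in> carrier G. conjugate g ` Z = Z}"
  have "conjugate (g \<otimes> h) ` Z = (\<lambda>z. conjugate g (conjugate h z)) ` Z"
    by (rule image_cong) (use gh Z in \<open>auto simp: conjugate_conjugate\<close>)
  also have "\<dots> = conjugate g ` conjugate h ` Z" by (simp add: image_image)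
  also have "\<dots> = Z" using gh by simp
  finally show "g \<otimes> h \<in> {g \<in> carrier G. conjugate g ` Z = Z}" using gh by simp
qed auto

end

section \<open>Graded rings\<close>

lemma prod_sumsI: "u \<in> U \<Longrightarrow> v \<in> V \<Longrightarrow> u * v \<in> prod_sums U V"
  unfolding prod_sums_def
  by (intro CollectI exI[of _ "1::nat"] exI[of _ "\<lambda>_. u"] exI[of _ "\<lambda>_. v"]) auto

lemma prod_sums_subset_add_subgroup:
  assumes "add_subgroup A" "\<And>u v. u \<in> U \<Longrightarrow> v \<in> V \<Longrightarrow> u * v \<in> A"
  shows "prod_sums U V \<subseteq> A"
proof
  fix s assume "s \<in> prod_sums U V"
  then obtain n :: nat and u v where s: "s = (\<Sum>i<n. u i * v i)" "\<forall>i<n. u i \<in> U \<and> v i \<in> V"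
    unfolding prod_sums_def by blast
  have "(\<Sum>i<m. u i * v i) \<in> A" if "m \<le> n" for m
    using that assms s(2) by (induction m) (auto simp: add_subgroup_def)
  then show "s \<in> A" using s(1) by simp
qed

lemma prod_sums_eq_zero:
  assumes "\<And>u v. u \<in> U \<Longrightarrow> v \<in> V \<Longrightarrow> u * v = 0"
  shows "prod_sums U V = {0}"
proof -
  have "prod_sums U V \<subseteq> {0}"
    by (rule prod_sums_subset_add_subgroup) (auto simp: add_subgroup_def assms)
  moreover have "0 \<in> prod_sums U V"
    unfolding prod_sums_def by (intro CollectI exI[of _ "0::nat"]) auto
  ultimately show ?thesis by blast
qed

locale nearly_graded = group G for G (structure) +
  fixes S :: "'a \<Rightarrow> 'r::ring set"
  assumes nes: "nearly_epsilon_strongly_graded G S"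
begin

lemma S_subgroup: "x \<in> carrier G \<Longrightarrow> add_subgroup (S x)"
  using nes unfolding nearly_epsilon_strongly_graded_def graded_ring_def
    direct_sum_decomposition_def by blast

lemma S_zero [simp]: "x \<in> carrier G \<Longrightarrow> 0 \<in> S x"
  and S_add: "x \<in> carrier G \<Longrightarrow> a \<in> S x \<Longrightarrow> b \<in> S x \<Longrightarrow> a + b \<in> S x"
  and S_uminus: "x \<in> carrier G \<Longrightarrow> a \<in> S x \<Longrightarrow> - a \<in> S x"
  using S_subgroup unfolding add_subgroup_def by blast+

lemma S_mult:
  "a \<in> S x \<Longrightarrow> b \<in> S y \<Longrightarrow> x \<in> carrier G \<Longrightarrow> y \<in> carrier G \<Longrightarrow> a * b \<in> S (x \<otimes> y)"
  using nes prod_sumsI[of a "S x" b "S y"]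
  unfolding nearly_epsilon_strongly_graded_def graded_ring_def by blast

lemma left_unit:
  assumes "x \<in> carrier G" "s \<in> S x"
  obtains e where "e \<in> prod_sums (S x) (S (inv x))" "e * s = s"
  using nes assms unfolding nearly_epsilon_strongly_graded_def by metis

lemma right_unit:
  assumes "x \<in> carrier G" "s \<in> S x"
  obtains e where "e \<in> prod_sums (S (inv x)) (S x)" "s * e = s"
  using nes assms unfolding nearly_epsilon_strongly_graded_def by metis

lemma left_unit_one:
  assumes "x \<in> carrier G" "s \<in> S x"
  obtains e where "e \<in> S \<one>" "e * s = s"
proof -
  obtain e where e: "e \<in> prod_sums (S x) (S (inv x))" "e * s = s" using left_unit assms .
  have "prod_sums (S x) (S (inv x)) \<subseteq> S \<one>"
    by (rule prod_sums_subset_add_subgroup) (use S_subgroup S_mult[of _ x _ "inv x"] assms in auto)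
  then show thesis using that e by blast
qed

lemma right_unit_one:
  assumes "x \<in> carrier G" "s \<in> S x"
  obtains e where "e \<in> S \<one>" "s * e = s"
proof -
  obtain e where e: "e \<in> prod_sums (S (inv x)) (S x)" "s * e = s" using right_unit assms .
  have "prod_sums (S (inv x)) (S x) \<subseteq> S \<one>"
    by (rule prod_sums_subset_add_subgroup) (use S_subgroup S_mult[of _ "inv x" _ x] assms in auto)
  then show thesis using that e by blast
qed

text \<open>The right unit of \<open>s\<close> is a sum of products \<open>t * t'\<close> with
  \<open>t\<close> of degree \<open>inv x\<close>, so not all \<open>s * t\<close> can vanish. This
  moves a nonzero homogeneous element into the neutral component without killing it.\<close>

lemma right_push:
  assumes "x \<in> carrier G" "s \<in> S x" "s \<noteq> 0"
  obtains t where "t \<in> S (inv x)" "s * t \<noteq> 0"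
proof (rule ccontr)
  assume no: "\<not> thesis"
  obtain e where e: "e \<in> prod_sums (S (inv x)) (S x)" "s * e = s" using right_unit[OF assms(1,2)] .
  have "prod_sums (S (inv x)) (S x) \<subseteq> {e. s * e = 0}"
  proof (rule prod_sums_subset_add_subgroup)
    show "add_subgroup {e. s * e = 0}" by (auto simp: add_subgroup_def distrib_left)
    fix u v assume "u \<in> S (inv x)" "v \<in> S x"
    then have "s * u = 0" using no that by blast
    then show "u * v \<in> {e. s * e = 0}" by (simp add: mult.assoc[symmetric])
  qed
  then show False using e assms by auto
qed

lemma left_push:
  assumes "x \<in> carrier G" "s \<in> S x" "s \<noteq> 0"
  obtains t where "t \<in> S (inv x)" "t * s \<noteq> 0"
proof (rule ccontr)
  assume no: "\<not> thesis"
  obtain e where e: "e \<in> prod_sums (S x) (S (inv x))" "e * s = s" using left_unit[OF assms(1,2)] .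
  have "prod_sums (S x) (S (inv x)) \<subseteq> {e. e * s = 0}"
  proof (rule prod_sums_subset_add_subgroup)
    show "add_subgroup {e. e * s = 0}" by (auto simp: add_subgroup_def distrib_right)
    fix u v assume "u \<in> S x" "v \<in> S (inv x)"
    then have "v * s = 0" using no that by blast
    then show "u * v \<in> {e. e * s = 0}" by (simp add: mult.assoc)
  qed
  then show False using e assms by auto
qed

section \<open>Homogeneous components and supports\<close>

definition prj :: "'r \<Rightarrow> 'a \<Rightarrow> 'r" where
  "prj s = (THE f. (\<forall>x\<in>carrier G. f x \<in> S x) \<and> (\<forall>x. x \<notin> carrier G \<longrightarrow> f x = 0) \<and>
     finite {x. f x \<noteq> 0} \<and> s = (\<Sum>x | f x \<noteq> 0. f x))"

definition supp :: "'r \<Rightarrow> 'a set" where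
  "supp s = {x. prj s x \<noteq> 0}"

lemma prj_ex1:
  "\<exists>!f. (\<forall>x\<in>carrier G. f x \<in> S x) \<and> (\<forall>x. x \<notin> carrier G \<longrightarrow> f x = 0) \<and>
     finite {x. f x \<noteq> 0} \<and> s = (\<Sum>x | f x \<noteq> 0. f x)"
  using nes unfolding nearly_epsilon_strongly_graded_def graded_ring_def
    direct_sum_decomposition_def by blast

lemma prj_closed [simp]: "x \<in> carrier G \<Longrightarrow> prj s x \<in> S x"
  and supp_closed: "supp s \<subseteq> carrier G"
  and finite_supp [simp]: "finite (supp s)"
  and sum_prj: "s = (\<Sum>x\<in>supp s. prj s x)"
  using theI'[OF prj_ex1[of s]] unfolding prj_def[symmetric] supp_def by blast+

lemma prj_eq_zero: "x \<notin> supp s \<Longrightarrow> prj s x = 0"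
  by (simp add: supp_def)

lemma prj_unique:
  assumes "\<And>x. x \<in> carrier G \<Longrightarrow> f x \<in> S x" "finite A" "A \<subseteq> carrier G"
    "\<And>x. x \<notin> A \<Longrightarrow> f x = 0" "s = sum f A"
  shows "prj s = f"
  unfolding prj_def
proof (rule the1_equality[OF prj_ex1], intro conjI ballI allI impI)
  have sub: "{x. f x \<noteq> 0} \<subseteq> A" using assms(4) by blast
  then show "finite {x. f x \<noteq> 0}" using assms(2) finite_subset by blast
  show "s = (\<Sum>x | f x \<noteq> 0. f x)"
    unfolding assms(5) by (rule sum.mono_neutral_right) (use assms(2) sub in auto)
qed (use assms in auto)

lemma prj_add: "prj (s + t) x = prj s x + prj t x"
proof -
  let ?A = "supp s \<union> supp t"
  have "prj (s + t) = (\<lambda>x. prj s x + prj t x)"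
  proof (rule prj_unique[of _ ?A])
    have "s = sum (prj s) ?A"
      by (subst sum_prj, rule sum.mono_neutral_left) (auto simp: prj_eq_zero)
    moreover have "t = sum (prj t) ?A"
      by (subst sum_prj, rule sum.mono_neutral_left) (auto simp: prj_eq_zero)
    ultimately show "s + t = (\<Sum>x\<in>?A. prj s x + prj t x)" by (simp add: sum.distrib)
    show "finite ?A" "?A \<subseteq> carrier G" using supp_closed by auto
    show "prj s x + prj t x \<in> S x" if "x \<in> carrier G" for x using that S_add by simp
    show "prj s x + prj t x = 0" if "x \<notin> ?A" for x using that by (simp add: supp_def)
  qed
  then show ?thesis by simp
qed

lemma prj_homogeneous: "z \<in> carrier G \<Longrightarrow> t \<in> S z \<Longrightarrow> prj t x = (if x = z then t else 0)"
  by (subst prj_unique[of "\<lambda>x. if x = z then t else 0" "{z}"]) auto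

lemma prj_zero [simp]: "prj 0 x = 0"
  using prj_homogeneous[of \<one> 0] by simp

lemma prj_sum: "prj (\<Sum>i\<in>I. f i) x = (\<Sum>i\<in>I. prj (f i) x)"
  by (induction I rule: infinite_finite_induct) (auto simp: prj_add)

lemma supp_empty_iff: "supp s = {} \<longleftrightarrow> s = 0"
  using sum_prj[of s] by (auto simp: supp_def)

lemma prj_mult:
  assumes "g \<in> carrier G" "u \<in> S g" "k \<in> carrier G" "v \<in> S k" "w \<in> carrier G"
  shows "prj (u * s * v) w = u * prj s (inv g \<otimes> w \<otimes> inv k) * v"
proof -
  let ?z = "inv g \<otimes> w \<otimes> inv k"
  have eq: "w = g \<otimes> x \<otimes> k \<longleftrightarrow> x = ?z" if "x \<in> carrier G" for x
  proof
    assume "w = g \<otimes> x \<otimes> k"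
    then have "w \<otimes> inv k = g \<otimes> x" using assms that by (simp add: m_assoc)
    moreover have "inv g \<otimes> (g \<otimes> x) = x" using assms that by (simp add: m_assoc[symmetric])
    ultimately show "x = ?z" using assms that by (simp add: m_assoc)
  next
    have "g \<otimes> (inv g \<otimes> (w \<otimes> inv k)) = w \<otimes> inv k"
      using assms by (simp add: m_assoc[symmetric])
    moreover assume "x = ?z"
    ultimately show "w = g \<otimes> x \<otimes> k" using assms by (simp add: m_assoc)
  qed
  have "u * s * v = (\<Sum>x\<in>supp s. u * prj s x * v)"
    by (subst sum_prj[of s]) (simp only: sum_distrib_left sum_distrib_right)
  then have "prj (u * s * v) w = (\<Sum>x\<in>supp s. prj (u * prj s x * v) w)"
    by (simp add: prj_sum)
  also have "\<dots> = (\<Sum>x\<in>supp s. if x = ?z then u * prj s x * v else 0)"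
  proof (rule sum.cong[OF refl])
    fix x assume "x \<in> supp s"
    then have x: "x \<in> carrier G" using supp_closed by blast
    then have "u * prj s x * v \<in> S (g \<otimes> x \<otimes> k)" using assms by (intro S_mult) auto
    then show "prj (u * prj s x * v) w = (if x = ?z then u * prj s x * v else 0)"
      using prj_homogeneous[of "g \<otimes> x \<otimes> k"] assms x eq[OF x] by auto
  qed
  also have "\<dots> = u * prj s ?z * v"
    by (auto simp: prj_eq_zero)
  finally show ?thesis .
qed

lemma prj_mult_right:
  assumes "k \<in> carrier G" "v \<in> S k" "w \<in> carrier G"
  shows "prj (s * v) w = prj s (w \<otimes> inv k) * v"
proof -
  have eq: "w = x \<otimes> k \<longleftrightarrow> x = w \<otimes> inv k" if "x \<in> carrier G" for x
    using that assms by (auto simp: m_assoc)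
  have "s * v = (\<Sum>x\<in>supp s. prj s x * v)"
    by (subst sum_prj[of s]) (simp only: sum_distrib_right)
  then have "prj (s * v) w = (\<Sum>x\<in>supp s. prj (prj s x * v) w)"
    by (simp add: prj_sum)
  also have "\<dots> = (\<Sum>x\<in>supp s. if x = w \<otimes> inv k then prj s x * v else 0)"
  proof (rule sum.cong[OF refl])
    fix x assume "x \<in> supp s"
    then have x: "x \<in> carrier G" using supp_closed by blast
    then have "prj s x * v \<in> S (x \<otimes> k)" using assms by (intro S_mult) auto
    then show "prj (prj s x * v) w = (if x = w \<otimes> inv k then prj s x * v else 0)"
      using prj_homogeneous[of "x \<otimes> k"] assms x eq[OF x] by auto
  qed
  also have "\<dots> = prj s (w \<otimes> inv k) * v"
    by (auto simp: prj_eq_zero)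
  finally show ?thesis .
qed

text \<open>Nothing can cancel the product of the two components, since no other pair contributes to
  its degree.\<close>

lemma homogeneous_zero_if_isolated:
  assumes zero: "a * s * b = 0" and h: "h \<in> carrier G" "s \<in> S h"
    and xy: "x \<in> supp a" "y \<in> supp b"
    and iso: "\<And>x' y'. x' \<in> supp a \<Longrightarrow> y' \<in> supp b \<Longrightarrow> x' \<otimes> h \<otimes> y' = x \<otimes> h \<otimes> y \<Longrightarrow> x' = x \<and> y' = y"
  shows "prj a x * s * prj b y = 0"
proof -
  let ?z = "x \<otimes> h \<otimes> y"
  have expand: "a * s * b = (\<Sum>(x', y')\<in>supp a \<times> supp b. prj a x' * s * prj b y')"
  proof -
    have "a * s * b = (\<Sum>x\<in>supp a. prj a x * s * b)"
      by (subst sum_prj[of a]) (simp only: sum_distrib_right)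
    also have "\<dots> = (\<Sum>x\<in>supp a. \<Sum>y\<in>supp b. prj a x * s * prj b y)"
      by (intro sum.cong refl, subst sum_prj[of b]) (simp only: sum_distrib_left)
    finally show ?thesis by (simp add: sum.cartesian_product)
  qed
  have "0 = prj (a * s * b) ?z" using zero by simp
  also have "\<dots> = (\<Sum>(x', y')\<in>supp a \<times> supp b. prj (prj a x' * s * prj b y') ?z)"
    unfolding expand prj_sum by (simp add: split_def)
  also have "\<dots> = (\<Sum>p\<in>supp a \<times> supp b. if p = (x, y) then prj a x * s * prj b y else 0)"
  proof (rule sum.cong[OF refl])
    fix p assume "p \<in> supp a \<times> supp b"
    then obtain x' y' where p: "p = (x', y')" "x' \<in> supp a" "y' \<in> supp b" by blast
    then have c: "x' \<in> carrier G" "y' \<in> carrier G" using supp_closed by auto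
    then have "prj a x' * s * prj b y' \<in> S (x' \<otimes> h \<otimes> y')" using h by (intro S_mult) auto
    then have "prj (prj a x' * s * prj b y') ?z =
        (if ?z = x' \<otimes> h \<otimes> y' then prj a x' * s * prj b y' else 0)"
      using prj_homogeneous[of "x' \<otimes> h \<otimes> y'"] c h by simp
    then show "(case p of (x', y') \<Rightarrow> prj (prj a x' * s * prj b y') ?z) =
        (if p = (x, y) then prj a x * s * prj b y else 0)"
      using iso[OF p(2,3)] p(1) by auto
  qed
  also have "\<dots> = prj a x * s * prj b y" using xy by simp
  finally show ?thesis by simp
qed

section \<open>Links between homogeneous elements\<close>

definition nzhom :: "'r \<Rightarrow> bool" where
  "nzhom a \<longleftrightarrow> a \<noteq> 0 \<and> (\<exists>x\<in>carrier G. a \<in> S x)"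

definition linked :: "'r \<Rightarrow> 'r \<Rightarrow> 'a set" where
  "linked a b = {h \<in> carrier G. \<exists>s\<in>S h. a * s * b \<noteq> 0}"

lemma linked_closed: "linked a b \<subseteq> carrier G"
  by (auto simp: linked_def)

lemma nzhom_prj: "x \<in> supp s \<Longrightarrow> nzhom (prj s x)"
  using supp_closed[of s] prj_closed[of x s] unfolding nzhom_def supp_def by blast

lemma nzhom_mult: "nzhom a \<Longrightarrow> nzhom b \<Longrightarrow> a * b \<noteq> 0 \<Longrightarrow> nzhom (a * b)"
  unfolding nzhom_def using S_mult by blast

lemma nzhom_mult3:
  assumes "nzhom a" "nzhom b" "h \<in> carrier G" "s \<in> S h" "a * s * b \<noteq> 0"
  shows "nzhom (a * s * b)"
proof -
  have "a * s \<noteq> 0" "s \<noteq> 0" using assms(5) by auto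
  then show ?thesis using assms nzhom_mult by (metis nzhom_def)
qed

lemma linked_mult_left: "linked (p * a) b \<subseteq> linked a b"
proof
  fix h assume "h \<in> linked (p * a) b"
  then obtain s where s: "h \<in> carrier G" "s \<in> S h" "p * a * s * b \<noteq> 0"
    by (auto simp: linked_def)
  then have "p * (a * s * b) \<noteq> 0" by (simp add: mult.assoc)
  then have "a * s * b \<noteq> 0" by auto
  then show "h \<in> linked a b" using s by (auto simp: linked_def)
qed

lemma linked_mult_right: "linked a (b * p) \<subseteq> linked a b"
proof
  fix h assume "h \<in> linked a (b * p)"
  then obtain s where s: "h \<in> carrier G" "s \<in> S h" "a * s * (b * p) \<noteq> 0"
    by (auto simp: linked_def)
  then have "(a * s * b) * p \<noteq> 0" by (simp add: mult.assoc)
  then have "a * s * b \<noteq> 0" by auto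
  then show "h \<in> linked a b" using s by (auto simp: linked_def)
qed

text \<open>The source of all translations of coverings: the links of \<open>a * v\<close> lie in
  the translate of those of \<open>a\<close> by \<open>inv g\<close>.\<close>

lemma linked_shift_left:
  assumes "h \<in> linked (a * v) b" "g \<in> carrier G" "v \<in> S g"
  shows "g \<otimes> h \<in> linked a b"
proof -
  obtain s where s: "h \<in> carrier G" "s \<in> S h" "a * v * s * b \<noteq> 0"
    using assms by (auto simp: linked_def)
  then have "v * s \<in> S (g \<otimes> h)" "a * (v * s) * b \<noteq> 0"
    using assms S_mult by (auto simp: mult.assoc)
  then show ?thesis using assms s(1) unfolding linked_def by blast
qed

end

text \<open>When the elements of \<open>Q\<close> are added one by one, \<open>R\<close> turns true
  at some step, and \<open>w\<close> is the element added there. It serves to isolate a single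
  quotient whose centralizer is indispensable for smallness.\<close>

lemma finite_critical_insert:
  assumes "finite Q" "\<not> R {}" "R Q"
  obtains w Q' where "insert w Q' \<subseteq> Q" "\<not> R Q'" "R (insert w Q')"
  using assms
proof (induction Q arbitrary: thesis rule: finite_induct)
  case (insert x F)
  show ?case
  proof (cases "R F")
    case True
    obtain w Q' where "insert w Q' \<subseteq> F" "\<not> R Q'" "R (insert w Q')"
      using insert.IH[OF _ insert.prems(2) True] by metis
    then show ?thesis using insert.prems(1)[of w Q'] by blast
  next
    case False
    then show ?thesis using insert.prems(1)[of x F] insert.prems(3) by blast
  qed
qed simp

section \<open>Primeness implies G-primeness\<close>

lemma prime_ring_elementwise:
  fixes a b e :: "'r::ring"
  assumes prime: "prime_ring (UNIV :: 'r set)" and e: "e * b = b"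
    and zero: "\<And>s. a * s * b = 0"
  shows "a = 0 \<or> b = 0"
proof -
  define X where "X = {t. \<forall>s. a * s * t = 0}"
  define Y where "Y = {u. \<forall>s. \<forall>t\<in>X. u * s * t = 0}"
  \<comment> \<open>For \<open>t\<close> in \<open>X\<close>, the equations
    \<open>u * s * t = 0\<close> give \<open>u * t = 0\<close> if \<open>t\<close> has a left unit,
    but such a unit is given for \<open>b\<close> alone. Hence \<open>X\<close> is replaced by the
    right annihilator of \<open>Y\<close>, which still contains \<open>b\<close>.\<close>
  define X' where "X' = {t. \<forall>u\<in>Y. u * t = 0}"
  have X_left: "s * t \<in> X" if "t \<in> X" for s t
  proof -
    have "a * (s' * s) * t = 0" for s' using that by (simp add: X_def)
    then show ?thesis by (simp add: X_def mult.assoc)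
  qed
  have Y_right: "u * r \<in> Y" if "u \<in> Y" for u r
  proof -
    have "u * (r * s) * t = 0" if "t \<in> X" for s t using that \<open>u \<in> Y\<close> by (simp add: Y_def)
    then show ?thesis by (simp add: Y_def mult.assoc)
  qed
  have Y_left: "r * u \<in> Y" if "u \<in> Y" for u r
    using that unfolding Y_def by (simp add: mult.assoc)
  have "ideal_of Y UNIV"
    using Y_left Y_right unfolding ideal_of_def add_subgroup_def
    by (auto simp: Y_def distrib_right)
  moreover have "ideal_of X' UNIV"
    using Y_right unfolding ideal_of_def add_subgroup_def
    by (auto simp: X'_def distrib_left mult.assoc[symmetric])
  moreover have "prod_sums Y X' = {0}"
    by (rule prod_sums_eq_zero) (auto simp: X'_def)
  ultimately have "Y = {0} \<or> X' = {0}" using prime unfolding prime_ring_def by blast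
  moreover have "a \<in> Y" by (auto simp: Y_def X_def)
  moreover have "b \<in> X'"
  proof -
    have "b \<in> X" using zero by (simp add: X_def)
    then have "u * e * b = 0" if "u \<in> Y" for u using that by (simp add: Y_def)
    then show ?thesis using e by (simp add: X'_def mult.assoc)
  qed
  ultimately show ?thesis by blast
qed

context nearly_graded
begin

lemma neutral_component_nonzero:
  assumes "(UNIV :: 'r set) \<noteq> {0}"
  shows "S \<one> \<noteq> {0}"
proof
  assume S1: "S \<one> = {0}"
  have "s = 0" for s :: 'r
  proof (rule ccontr)
    assume "s \<noteq> 0"
    then obtain x where "x \<in> supp s" using supp_empty_iff by blast
    then have x: "x \<in> carrier G" "prj s x \<noteq> 0" using supp_closed by (auto simp: supp_def)
    obtain e where "e \<in> S \<one>" "e * prj s x = prj s x"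
      using left_unit_one[OF x(1) prj_closed[OF x(1)]] .
    then show False using S1 x(2) by simp
  qed
  then show False using assms by auto
qed

lemma zero_ideal: "R \<in> {UNIV, S \<one>} \<Longrightarrow> ideal_of {0} R"
  by (auto simp: ideal_of_def add_subgroup_def)

text \<open>Writing \<open>a s = \<epsilon> a s\<close> with \<open>\<epsilon>\<close> in the product of the components of degrees \<open>x\<close> and \<open>x\<inverse>\<close>
  shows that \<open>A S x\<close> is contained in \<open>S x A\<close> for every invariant ideal \<open>A\<close>.\<close>

lemma invariant_ideals_annihilate:
  assumes A: "ideal_of A (S \<one>)" "G_invariant G S A" and AB: "prod_sums A B = {0}"
    and a: "a \<in> A" and b: "b \<in> B"
  shows "a * s * b = 0"
proof -
  have hom: "a * s * b = 0" if x: "x \<in> carrier G" and s: "s \<in> S x" for x s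
  proof -
    have "a \<in> S \<one>" using A a by (auto simp: ideal_of_def)
    then have "a * s \<in> S (\<one> \<otimes> x)" using x s by (intro S_mult) auto
    then obtain e where e: "e \<in> prod_sums (S x) (S (inv x))" "e * (a * s) = a * s"
      using left_unit[OF x, of "a * s"] x by auto
    have "prod_sums (S x) (S (inv x)) \<subseteq> {e. e * (a * s * b) = 0}"
    proof (rule prod_sums_subset_add_subgroup)
      show "add_subgroup {e. e * (a * s * b) = 0}" by (auto simp: add_subgroup_def distrib_right)
      fix u v assume uv: "u \<in> S x" "v \<in> S (inv x)"
      have "v * a * s \<in> A"
        using A(2) x prod_sumsI[OF prod_sumsI[OF uv(2) a] s] unfolding G_invariant_def by blast
      then have "v * a * s * b = 0" using prod_sumsI[OF _ b] AB by blast
      then have "u * v * (a * s * b) = 0" by (metis mult.assoc mult_zero_right)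
      then show "u * v \<in> {e. e * (a * s * b) = 0}" by simp
    qed
    then have "e * (a * s * b) = 0" using e(1) by blast
    then show ?thesis using e(2) by (metis mult.assoc)
  qed
  have "a * s * b = (\<Sum>x\<in>supp s. a * prj s x * b)"
    by (subst sum_prj[of s]) (simp only: sum_distrib_left sum_distrib_right)
  also have "\<dots> = 0"
  proof (rule sum.neutral, rule ballI)
    fix x assume "x \<in> supp s"
    then have "x \<in> carrier G" using supp_closed by blast
    then show "a * prj s x * b = 0" using hom by simp
  qed
  finally show ?thesis .
qed

lemma prime_imp_G_prime:
  assumes nz: "(UNIV :: 'r set) \<noteq> {0}" and prime: "prime_ring (UNIV :: 'r set)"
  shows "G_prime G S"
  unfolding G_prime_def
proof (intro conjI allI impI)
  show "proper_ideal_of {0} (S \<one>)"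
    using zero_ideal neutral_component_nonzero[OF nz] by (auto simp: proper_ideal_of_def)
next
  fix A B assume *: "ideal_of A (S \<one>) \<and> G_invariant G S A \<and>
    ideal_of B (S \<one>) \<and> G_invariant G S B \<and> prod_sums A B = {0}"
  have zero: "0 \<in> A" "0 \<in> B" using * by (auto simp: ideal_of_def add_subgroup_def)
  have "a = 0 \<or> b = 0" if ab: "a \<in> A" "b \<in> B" for a b
  proof -
    have "b \<in> S \<one>" using * ab by (auto simp: ideal_of_def)
    then obtain e where "e * b = b" using left_unit_one[OF one_closed] by metis
    moreover have "\<And>s. a * s * b = 0" using invariant_ideals_annihilate * ab by blast
    ultimately show ?thesis using prime_ring_elementwise[OF prime] by blast
  qed
  then show "A = {0} \<or> B = {0}" using zero by blast
qed

end

section \<open>G-prime gradings\<close>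

locale G_prime_graded = nearly_graded G S for G (structure) and S :: "'a \<Rightarrow> 'r::ring set" +
  assumes G_prime: "G_prime G S"
begin

text \<open>G-primeness enters only here. Without links, the right annihilator \<open>X\<close> of
  all \<open>a * s\<close> in the neutral component and the set \<open>Y\<close> of elements
  \<open>u\<close> with \<open>u * s * t = 0\<close> for all homogeneous \<open>s\<close> and all
  \<open>t\<close> in \<open>X\<close> would be nonzero invariant ideals with product zero.
  Annihilators avoid describing the invariant ideals generated by \<open>a\<close> and
  \<open>b\<close>.\<close>

lemma linked_nonempty:
  assumes a: "nzhom a" and b: "nzhom b"
  shows "linked a b \<noteq> {}"
proof
  assume "linked a b = {}"
  then have zero: "a * s * b = 0" if "h \<in> carrier G" "s \<in> S h" for h s
    using that by (auto simp: linked_def)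
  define X where "X = {t \<in> S \<one>. \<forall>h\<in>carrier G. \<forall>s\<in>S h. a * s * t = 0}"
  define Y where "Y = {u \<in> S \<one>. \<forall>h\<in>carrier G. \<forall>s\<in>S h. \<forall>t\<in>X. u * s * t = 0}"
  have S1_mult: "u * v \<in> S \<one>" if "u \<in> S \<one>" "v \<in> S \<one>" for u v
    using S_mult[OF that] by simp
  have conj_S1: "v * t * w \<in> S \<one>"
    if "x \<in> carrier G" "v \<in> S (inv x)" "t \<in> S \<one>" "w \<in> S x" for x v t w
    using S_mult[OF S_mult[OF that(2,3)] that(4)] that(1) by simp
  have X_mult: "v * t * w \<in> X"
    if v: "g \<in> carrier G" "v \<in> S g" and t: "t \<in> X" and c: "v * t * w \<in> S \<one>" for v t w g
  proof -
    have "a * s * (v * t * w) = 0" if "h \<in> carrier G" "s \<in> S h" for h s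
    proof -
      have "a * (s * v) * t = 0" using t S_mult[OF that(2) v(2)] that v by (auto simp: X_def)
      then have "a * (s * v) * t * w = 0" by simp
      then show ?thesis by (simp add: mult.assoc)
    qed
    then show ?thesis using c by (auto simp: X_def)
  qed
  have Y_mult: "v * t * w \<in> Y"
    if w: "g \<in> carrier G" "w \<in> S g" and t: "t \<in> Y" and c: "v * t * w \<in> S \<one>" for v t w g
  proof -
    have "v * t * w * s * r = 0" if "h \<in> carrier G" "s \<in> S h" "r \<in> X" for h s r
    proof -
      have "t * (w * s) * r = 0" using t S_mult[OF w(2) that(2)] that w by (auto simp: Y_def)
      then have "v * (t * (w * s) * r) = 0" by simp
      then show ?thesis by (simp add: mult.assoc)
    qed
    then show ?thesis using c by (auto simp: Y_def)
  qed
  have X_lr: "r * t \<in> X \<and> t * r \<in> X" if rt: "r \<in> S \<one>" "t \<in> X" for r t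
  proof -
    have tS: "t \<in> S \<one>" using rt by (simp add: X_def)
    obtain e where e: "e \<in> S \<one>" "e * t = t" using left_unit_one[OF one_closed tS] .
    obtain e' where e': "e' \<in> S \<one>" "t * e' = t" using right_unit_one[OF one_closed tS] .
    \<comment> \<open>\<open>X_mult\<close> wants a factor on both sides of \<open>t\<close>; the
      one-sided units of \<open>t\<close> supply the missing one.\<close>
    have "r * t * e' \<in> X" by (intro X_mult[OF one_closed] S1_mult rt e' tS)
    moreover have "e * t * r \<in> X" by (intro X_mult[OF one_closed] S1_mult rt e tS)
    ultimately show ?thesis using e e' by (simp add: mult.assoc)
  qed
  have Y_lr: "r * t \<in> Y \<and> t * r \<in> Y" if rt: "r \<in> S \<one>" "t \<in> Y" for r t
  proof -
    have tS: "t \<in> S \<one>" using rt by (simp add: Y_def)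
    obtain e where e: "e \<in> S \<one>" "e * t = t" using left_unit_one[OF one_closed tS] .
    obtain e' where e': "e' \<in> S \<one>" "t * e' = t" using right_unit_one[OF one_closed tS] .
    have "r * t * e' \<in> Y" by (intro Y_mult[OF one_closed] S1_mult rt e' tS)
    moreover have "e * t * r \<in> Y" by (intro Y_mult[OF one_closed] S1_mult rt e tS)
    ultimately show ?thesis using e e' by (simp add: mult.assoc)
  qed
  have addX: "add_subgroup X" and addY: "add_subgroup Y"
    using S_add[OF one_closed] S_uminus[OF one_closed]
    by (auto simp: add_subgroup_def X_def Y_def distrib_left distrib_right)
  have "ideal_of X (S \<one>)" "ideal_of Y (S \<one>)"
    using X_lr Y_lr addX addY by (auto simp: ideal_of_def) (auto simp: X_def Y_def)
  moreover have "G_invariant G S X"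
    unfolding G_invariant_def
  proof
    fix x assume x: "x \<in> carrier G"
    have "prod_sums (S (inv x)) X \<subseteq> {z. \<forall>w\<in>S x. z * w \<in> X}"
    proof (rule prod_sums_subset_add_subgroup)
      show "add_subgroup {z. \<forall>w\<in>S x. z * w \<in> X}"
        using addX by (auto simp: add_subgroup_def distrib_right)
      show "v * t \<in> {z. \<forall>w\<in>S x. z * w \<in> X}" if "v \<in> S (inv x)" "t \<in> X" for v t
        using that x X_mult[of "inv x" v t] conj_S1[of x v t] by (auto simp: X_def mult.assoc)
    qed
    then show "prod_sums (prod_sums (S (inv x)) X) (S x) \<subseteq> X"
      by (intro prod_sums_subset_add_subgroup addX) blast
  qed
  moreover have "G_invariant G S Y"
    unfolding G_invariant_def
  proof
    fix x assume x: "x \<in> carrier G"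
    have "prod_sums (S (inv x)) Y \<subseteq> {z. \<forall>w\<in>S x. z * w \<in> Y}"
    proof (rule prod_sums_subset_add_subgroup)
      show "add_subgroup {z. \<forall>w\<in>S x. z * w \<in> Y}"
        using addY by (auto simp: add_subgroup_def distrib_right)
      show "v * t \<in> {z. \<forall>w\<in>S x. z * w \<in> Y}" if "v \<in> S (inv x)" "t \<in> Y" for v t
        using that x Y_mult[of x _ t v] conj_S1[of x v t] by (auto simp: Y_def)
    qed
    then show "prod_sums (prod_sums (S (inv x)) Y) (S x) \<subseteq> Y"
      by (intro prod_sums_subset_add_subgroup addY) blast
  qed
  moreover have "prod_sums Y X = {0}"
  proof (rule prod_sums_eq_zero)
    fix u t assume ut: "u \<in> Y" "t \<in> X"
    then have "t \<in> S \<one>" by (simp add: X_def)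
    then obtain e where e: "e \<in> S \<one>" "e * t = t" using left_unit_one[OF one_closed] by metis
    then have "u * e * t = 0" using ut by (auto simp: Y_def)
    then show "u * t = 0" using e by (simp add: mult.assoc)
  qed
  ultimately have "Y = {0} \<or> X = {0}" using G_prime unfolding G_prime_def by blast
  \<comment> \<open>\<open>a\<close> and \<open>b\<close> may have any degree; pushing them into the
    neutral component gives nonzero elements of \<open>Y\<close> and \<open>X\<close>.\<close>
  moreover obtain p where p: "p \<in> carrier G" "a \<in> S p" "a \<noteq> 0" using a by (auto simp: nzhom_def)
  obtain v where v: "v \<in> S (inv p)" "v * a \<noteq> 0" using left_push[OF p] .
  have "v * a \<in> Y"
    using S_mult[OF v(1) p(2)] p by (auto simp: Y_def X_def mult.assoc)
  moreover obtain q where q: "q \<in> carrier G" "b \<in> S q" "b \<noteq> 0" using b by (auto simp: nzhom_def)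
  obtain w where w: "w \<in> S (inv q)" "b * w \<noteq> 0" using right_push[OF q] .
  have "b * w \<in> X"
    using S_mult[OF q(2) w(1)] q zero by (auto simp: X_def mult.assoc[symmetric])
  ultimately show False using v w by blast
qed

section \<open>The stabilizer argument\<close>

text \<open>Choose \<open>d = b0 q\<close> such that, up to small sets, \<open>linked d b\<close> meets as few cosets of the centralizer of
  \<open>w\<close> as possible. If \<open>g\<close> lies in \<open>linked d d\<close>, then some \<open>d v d\<close> of degree \<open>g\<close> is linked to \<open>b\<close> only through
  cosets that stay in the list under translation by \<open>g\<close>; minimality makes \<open>g\<close> permute the list.\<close>

lemma linked_self_stabilizer:
  assumes y: "y \<in> carrier G" "b0 \<in> S y" and w: "w \<in> carrier G" and Q: "Q \<subseteq> carrier G"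
    and not_small: "\<And>a k q. nzhom a \<Longrightarrow> k \<in> carrier G \<Longrightarrow> q \<in> S k \<Longrightarrow> nzhom (b0 * q) \<Longrightarrow>
      \<not> small Q (linked a (b0 * q))"
    and ex: "nzhom a0" "k0 \<in> carrier G" "q0 \<in> S k0" "nzhom (b0 * q0)"
      "small (insert w Q) (linked a0 (b0 * q0))"
  obtains q H where "q \<in> S (inv y)" "b0 * q \<noteq> 0" "subgroup H G"
    "linked (b0 * q) (b0 * q) \<subseteq> H" "w \<in> fin_conj H"
proof -
  \<comment> \<open>Only right multiples of \<open>b0\<close> compete, so that the pair
    \<open>d\<close>, \<open>d\<close> below does too and \<open>d\<close> has the form
    \<open>b0 * q\<close>.\<close>
  define K where "K = {b. nzhom b \<and> (\<exists>k\<in>carrier G. \<exists>q\<in>S k. b = b0 * q)}"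
  define cov where "cov a b n \<longleftrightarrow> (\<exists>Z. finite Z \<and> Z \<subseteq> carrier G \<and> card Z \<le> n \<and>
    small Q {h \<in> linked a b. conjugate h w \<notin> Z})" for a b n
  have not_small_K: "\<not> small Q (linked a b)" if "nzhom a" "b \<in> K" for a b
    using not_small that unfolding K_def by blast
  define P where "P n \<longleftrightarrow> (\<exists>a b. nzhom a \<and> b \<in> K \<and> cov a b n)" for n
  have "\<exists>n. P n"
  proof -
    obtain Z where Z: "finite Z" "\<forall>h\<in>linked a0 (b0 * q0). \<exists>w'\<in>insert w Q. conjugate h w' \<in> Z"
      using ex(5) by (auto simp: small_def)
    have "\<forall>h\<in>{h \<in> linked a0 (b0 * q0). conjugate h w \<notin> Z \<inter> carrier G}. \<exists>w\<in>Q. conjugate h w \<in> Z"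
      using Z(2) w linked_closed by fastforce
    then have "small Q {h \<in> linked a0 (b0 * q0). conjugate h w \<notin> Z \<inter> carrier G}"
      using Z(1) unfolding small_def by blast
    then have "cov a0 (b0 * q0) (card (Z \<inter> carrier G))"
      unfolding cov_def using Z(1) by (intro exI[of _ "Z \<inter> carrier G"]) auto
    moreover have "b0 * q0 \<in> K" using ex by (auto simp: K_def)
    ultimately show ?thesis using ex(1) unfolding P_def by blast
  qed
  define n where "n = (LEAST n. P n)"
  have Pn: "P n" unfolding n_def using \<open>\<exists>n. P n\<close> by (rule LeastI_ex)
  have n_le: "n \<le> m" if "nzhom a" "b \<in> K" "cov a b m" for a b m
    unfolding n_def by (rule Least_le) (use that in \<open>auto simp: P_def\<close>)
  obtain a b Z where ab: "nzhom a" "b \<in> K" and Z: "finite Z" "Z \<subseteq> carrier G" "card Z \<le> n"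
    "small Q {h \<in> linked a b. conjugate h w \<notin> Z}"
    using Pn unfolding P_def cov_def by blast
  obtain k q where kq: "k \<in> carrier G" "q \<in> S k" "b = b0 * q" "nzhom b"
    using ab by (auto simp: K_def)
  obtain p where p: "p \<in> carrier G" "a \<in> S p" using ab by (auto simp: nzhom_def)
  obtain g u where gu: "g \<in> carrier G" "u \<in> S g" "b * u * a \<noteq> 0"
    using linked_nonempty[OF kq(4) ab(1)] by (auto simp: linked_def)
  \<comment> \<open>\<open>s\<close> has degree \<open>inv r\<close>, which puts \<open>d\<close>
    into the neutral component: then \<open>v * d\<close> has the same degree as \<open>v\<close>.
    As \<open>d\<close> is a left multiple of \<open>a * s\<close>, its links to \<open>b\<close>
    lie in the translate by \<open>r\<close> of those of \<open>a\<close>.\<close>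
  define r where "r = y \<otimes> k \<otimes> g \<otimes> p"
  have r: "r \<in> carrier G" "b * u * a \<in> S r"
    unfolding r_def kq(3) using y kq gu p by (auto intro!: S_mult)
  obtain s where s: "s \<in> S (inv r)" "b * u * a * s \<noteq> 0" using right_push[OF r gu(3)] .
  define d where "d = b * u * a * s"
  define q' where "q' = q * u * a * s"
  have d: "d \<noteq> 0" "d = b0 * q'" "d \<in> S \<one>"
    using s S_mult[OF r(2) s(1)] r by (auto simp: d_def q'_def kq(3) mult.assoc)
  have "q' \<in> S (k \<otimes> g \<otimes> p \<otimes> inv r)"
    unfolding q'_def using kq gu p s r by (auto intro!: S_mult)
  moreover have "k \<otimes> g \<otimes> p \<otimes> inv r = inv y"
  proof -
    have "r = y \<otimes> (k \<otimes> g \<otimes> p)" unfolding r_def using y kq gu p by (simp add: m_assoc)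
    then have "inv r = inv (k \<otimes> g \<otimes> p) \<otimes> inv y" using y kq gu p by (simp add: inv_mult_group)
    then show ?thesis using y kq gu p by (simp add: m_assoc[symmetric])
  qed
  ultimately have q': "q' \<in> S (inv y)" by simp
  have dK: "d \<in> K" "nzhom d" using d q' y by (auto simp: K_def nzhom_def)
  define Z1 where "Z1 = conjugate r ` Z"
  have Z1: "finite Z1" "Z1 \<subseteq> carrier G" "card Z1 \<le> n"
    using Z r card_image_le[OF Z(1), of "conjugate r"] by (auto simp: Z1_def)
  have small_db: "small Q {h \<in> linked d b. conjugate h w \<notin> Z1}"
  proof (rule small_mono[OF small_shift[OF Z(4) Q, of "inv r"]])
    show "inv r \<in> carrier G" using r by simp
    show "{h \<in> linked d b. conjugate h w \<notin> Z1}
      \<subseteq> {h \<in> carrier G. inv r \<otimes> h \<in> {h \<in> linked a b. conjugate h w \<notin> Z}}"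
    proof
      fix h assume h: "h \<in> {h \<in> linked d b. conjugate h w \<notin> Z1}"
      then have hc: "h \<in> carrier G" using linked_closed by blast
      have "h \<in> linked ((b * u) * (a * s)) b" using h by (simp add: d_def mult.assoc)
      then have "h \<in> linked (a * s) b" using linked_mult_left by blast
      then have "inv r \<otimes> h \<in> linked a b" using linked_shift_left s r by simp
      moreover have "conjugate h w = conjugate r (conjugate (inv r \<otimes> h) w)"
        using conjugate_shift[of "inv r" h w] hc w r by simp
      then have "conjugate (inv r \<otimes> h) w \<notin> Z" using h by (auto simp: Z1_def)
      ultimately show "h \<in> {h \<in> carrier G. inv r \<otimes> h \<in> {h \<in> linked a b. conjugate h w \<notin> Z}}"
        using hc by blast
    qed
  qed
  define H where "H = {g \<in> carrier G. conjugate g ` Z1 = Z1}"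
  have H: "subgroup H G" unfolding H_def by (rule subgroup_conjugate_stabilizer[OF Z1(2)])
  have dd_db: "linked d d \<subseteq> linked d b"
    using linked_mult_right[of d b "u * a * s"] by (simp add: d_def mult.assoc)
  have "linked d d \<subseteq> H"
  proof
    fix g assume g: "g \<in> linked d d"
    then have gc: "g \<in> carrier G" using linked_closed by blast
    obtain v where v: "v \<in> S g" "d * v * d \<noteq> 0" using g by (auto simp: linked_def)
    let ?a = "d * v * d"
    have a: "nzhom ?a" using nzhom_mult3 dK(2) gc v by blast
    have sub1: "linked ?a b \<subseteq> linked d b" using linked_mult_left by blast
    have sub2: "g \<otimes> h \<in> linked d b" if "h \<in> linked ?a b" for h
    proof (rule linked_shift_left[of _ _ "v * d"])
      show "h \<in> linked (d * (v * d)) b" using that by (simp add: mult.assoc)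
      show "v * d \<in> S g" using S_mult[OF v(1) d(3)] gc by simp
    qed (rule gc)
    \<comment> \<open>If \<open>h\<close> links \<open>d * v * d\<close> to \<open>b\<close>, then
      both \<open>h\<close> and \<open>g \<otimes> h\<close> link \<open>d\<close> to
      \<open>b\<close>. So outside a small set, both \<open>conjugate h w\<close> and its conjugate
      under \<open>g\<close> lie in \<open>Z1\<close>.\<close>
    let ?Z = "{z \<in> Z1. conjugate g z \<in> Z1}"
    have "small Q {h \<in> linked ?a b. conjugate h w \<notin> ?Z}"
    proof (rule small_mono[OF small_Un[OF small_db small_shift[OF small_db Q gc]]])
      show "{h \<in> linked ?a b. conjugate h w \<notin> ?Z} \<subseteq> {h \<in> linked d b. conjugate h w \<notin> Z1} \<union>
          {h \<in> carrier G. g \<otimes> h \<in> {h \<in> linked d b. conjugate h w \<notin> Z1}}"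
      proof
        fix h assume h: "h \<in> {h \<in> linked ?a b. conjugate h w \<notin> ?Z}"
        then have hc: "h \<in> carrier G" using linked_closed by blast
        have "conjugate g (conjugate h w) = conjugate (g \<otimes> h) w"
          using hc gc w by (simp add: conjugate_conjugate)
        then show "h \<in> {h \<in> linked d b. conjugate h w \<notin> Z1} \<union>
          {h \<in> carrier G. g \<otimes> h \<in> {h \<in> linked d b. conjugate h w \<notin> Z1}}"
          using h hc sub1 sub2 by auto
      qed
    qed
    then have "cov ?a b (card ?Z)"
      unfolding cov_def using Z1 by (intro exI[of _ ?Z]) auto
    then have "n \<le> card ?Z" using n_le a ab by blast
    then have "?Z = Z1" using Z1 by (intro card_seteq) auto
    then have sub: "conjugate g ` Z1 \<subseteq> Z1" by blast
    have "inj_on (conjugate g) Z1"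
      using conjugate_inj gc Z1(2) by (meson inj_onI subsetD)
    then have "conjugate g ` Z1 = Z1" using endo_inj_surj[OF Z1(1) sub] by blast
    then show "g \<in> H" using gc by (simp add: H_def)
  qed
  \<comment> \<open>\<open>H\<close> permutes the finite set \<open>Z1\<close>, so
    \<open>w \<in> Z1\<close> suffices. By minimality for the pair \<open>d\<close>,
    \<open>d\<close>, no \<open>z\<close> in \<open>Z1\<close> can be omitted, so \<open>z\<close>
    is the conjugate of \<open>w\<close> under some \<open>g\<close> in \<open>linked d d\<close>;
    this \<open>g\<close> lies in \<open>H\<close>, which carries \<open>z\<close> back to
    \<open>w\<close> inside \<open>Z1\<close>.\<close>
  moreover have "w \<in> fin_conj H"
  proof -
    have not_small_dd: "\<not> small Q (linked d d)" using not_small_K dK by blast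
    have "Z1 \<noteq> {}"
      using small_mono[OF small_db, of "linked d d"] dd_db not_small_dd by auto
    then obtain z where z: "z \<in> Z1" by blast
    have "\<exists>g\<in>linked d d. conjugate g w = z"
    proof (rule ccontr)
      assume "\<not> (\<exists>g\<in>linked d d. conjugate g w = z)"
      then have "{h \<in> linked d d. conjugate h w \<notin> Z1 - {z}} \<subseteq> {h \<in> linked d b. conjugate h w \<notin> Z1}"
        using dd_db by blast
      then have "small Q {h \<in> linked d d. conjugate h w \<notin> Z1 - {z}}"
        using small_mono small_db by blast
      then have "cov d d (card (Z1 - {z}))"
        unfolding cov_def using Z1 by (intro exI[of _ "Z1 - {z}"]) auto
      then have "n \<le> card (Z1 - {z})" using n_le dK by blast
      then show False using card_Diff1_less[OF Z1(1) z] Z1(3) by linarith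
    qed
    then obtain g where g: "g \<in> H" "conjugate g w = z" using \<open>linked d d \<subseteq> H\<close> by blast
    then have gc: "g \<in> carrier G" by (simp add: H_def)
    have "conjugate (inv g) ` Z1 = Z1" using subgroup.m_inv_closed[OF H g(1)] by (simp add: H_def)
    moreover have "w = conjugate (inv g) z" using g gc w by auto
    ultimately have "w \<in> Z1" using z by blast
    then have "(\<lambda>h. conjugate h w) ` H \<subseteq> Z1" by (auto simp: H_def)
    from finite_subset[OF this Z1(1)] show ?thesis using w by (simp add: fin_conj_def)
  qed
  ultimately show thesis using that[of q' H] q' d H by simp
qed

section \<open>Forms of minimal defect\<close>

text \<open>Forms of minimal defect serve as minimal counterexamples: shrinking \<open>H\<close> enlarges \<open>fin_conj H\<close> and so lowers the defect.\<close>

definition form :: "'r set \<Rightarrow> 'a set \<Rightarrow> 'r \<Rightarrow> bool" where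
  "form B H \<beta> \<longleftrightarrow> subgroup H G \<and> \<beta> \<in> B \<and> \<beta> \<noteq> 0 \<and> supp \<beta> \<subseteq> H \<and>
     (\<forall>y\<in>supp \<beta>. \<forall>y'\<in>supp \<beta>. linked (prj \<beta> y) (prj \<beta> y') \<subseteq> H)"

definition defect :: "'a set \<Rightarrow> 'r \<Rightarrow> nat" where
  "defect H \<beta> = card {(y, y') \<in> supp \<beta> \<times> supp \<beta>. y' \<otimes> inv y \<notin> fin_conj H}"

text \<open>Smallness yields a critical quotient \<open>w\<close> and a subgroup \<open>H1\<close>
  under which \<open>w\<close> has only finitely many conjugates. Placing \<open>\<beta>\<close>
  between multiples of \<open>d\<close> confines its support and its links to
  \<open>H \<inter> H1\<close>, while \<open>w\<close> drops out of the defect.\<close>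

lemma smaller_form:
  assumes F: "form B H \<beta>" and B: "ideal_of B UNIV" and y: "y \<in> supp \<beta>"
    and Q: "Q = {y2 \<otimes> inv y1 | y1 y2. y1 \<in> supp \<beta> \<and> y2 \<in> supp \<beta>} - fin_conj H"
    and ex: "nzhom a" "k \<in> carrier G" "q \<in> S k" "nzhom (prj \<beta> y * q)"
      "small Q (linked a (prj \<beta> y * q))"
  obtains H' \<beta>' where "form B H' \<beta>'" "defect H' \<beta>' < defect H \<beta>"
proof -
  have H: "subgroup H G" "H \<subseteq> carrier G" using F subgroup.subset by (auto simp: form_def)
  have suppc: "supp \<beta> \<subseteq> carrier G" by (rule supp_closed)
  have yc: "y \<in> carrier G" using y suppc by blast
  define b where "b = prj \<beta> y"
  have b: "b \<in> S y" using yc by (simp add: b_def)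
  define R where "R Q \<longleftrightarrow> (\<exists>a k q. nzhom a \<and> k \<in> carrier G \<and> q \<in> S k \<and> nzhom (b * q) \<and>
    small Q (linked a (b * q)))" for Q
  have "Q \<subseteq> (\<lambda>(y1, y2). y2 \<otimes> inv y1) ` (supp \<beta> \<times> supp \<beta>)" unfolding Q by auto
  from finite_subset[OF this] have "finite Q" by simp
  moreover have "\<not> R {}" using linked_nonempty by (auto simp: R_def small_empty_iff)
  moreover have "R Q" using ex unfolding R_def b_def by blast
  ultimately obtain w Q' where w: "insert w Q' \<subseteq> Q" "\<not> R Q'" "R (insert w Q')"
    using finite_critical_insert[of Q R] by blast
  have Qc: "Q \<subseteq> carrier G" unfolding Q using suppc by auto
  obtain a k q where w': "nzhom a" "k \<in> carrier G" "q \<in> S k" "nzhom (b * q)"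
    "small (insert w Q') (linked a (b * q))" using w(3) unfolding R_def by blast
  obtain q H1 where q: "q \<in> S (inv y)" "b * q \<noteq> 0" and H1: "subgroup H1 G"
    "linked (b * q) (b * q) \<subseteq> H1" "w \<in> fin_conj H1"
  proof (rule linked_self_stabilizer[OF yc b, of w Q'])
    show "w \<in> carrier G" "Q' \<subseteq> carrier G" using w Qc by auto
    show "\<not> small Q' (linked a (b * q))"
      if "nzhom a" "k \<in> carrier G" "q \<in> S k" "nzhom (b * q)" for a k q
      using that w(2) unfolding R_def by blast
  qed (use w' in auto)
  define d where "d = b * q"
  have d: "d \<in> S \<one>" "d \<noteq> 0" "nzhom d"
    using S_mult[OF b q(1)] q yc by (auto simp: d_def nzhom_def)
  define H' where "H' = H \<inter> H1"
  have H': "subgroup H' G" "H' \<subseteq> H" "H' \<subseteq> carrier G"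
    unfolding H'_def using H H1 subgroups_Inter_pair by auto
  have "linked d d \<subseteq> H"
  proof
    fix h assume h: "h \<in> linked d d"
    then have hc: "h \<in> carrier G" using linked_closed by blast
    have "h \<in> linked (b * q) b" using h linked_mult_right by (auto simp: d_def)
    then have "inv y \<otimes> h \<in> linked b b" using linked_shift_left q yc by simp
    then have "inv y \<otimes> h \<in> H" "y \<in> H" using F y by (auto simp: form_def b_def)
    then have "y \<otimes> (inv y \<otimes> h) \<in> H" using subgroup.m_closed[OF H(1)] by blast
    then show "h \<in> H" using yc hc by (simp add: m_assoc[symmetric])
  qed
  then have dd: "linked d d \<subseteq> H'" using H1(2) by (simp add: H'_def d_def)
  obtain h v where h: "h \<in> carrier G" "v \<in> S h" "d * v * d \<noteq> 0"
    using linked_nonempty[OF d(3,3)] by (auto simp: linked_def)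
  have hH': "h \<in> H'" using dd h by (auto simp: linked_def)
  have "nzhom (d * v * d)" using nzhom_mult3 d h by blast
  then obtain k v' where k: "k \<in> carrier G" "v' \<in> S k" "d * v * d * v' * d \<noteq> 0"
    using linked_nonempty[OF _ d(3)] unfolding linked_def by blast
  \<comment> \<open>Every component of \<open>\<beta>'\<close> has the form
    \<open>d * t * d\<close>, so the degree of a nonzero one links \<open>d\<close> to itself. The
    factors \<open>v\<close> and \<open>v'\<close> keep nonzero the component that comes from
    \<open>y\<close>, namely \<open>d * v * d * v' * d\<close>.\<close>
  define \<beta>' where "\<beta>' = d * v * \<beta> * (q * v' * d)"
  let ?k = "inv y \<otimes> k"
  have deg: "d * v \<in> S h" "q * v' * d \<in> S ?k"
    using S_mult[OF d(1) h(2)] S_mult[OF S_mult[OF q(1) k(2)] d(1)] h k yc by auto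
  define \<phi> where "\<phi> z = inv h \<otimes> z \<otimes> inv ?k" for z
  have kc: "?k \<in> carrier G" using k yc by simp
  have prj': "prj \<beta>' z = d * v * prj \<beta> (\<phi> z) * (q * v' * d)" if "z \<in> carrier G" for z
    unfolding \<beta>'_def \<phi>_def using prj_mult[OF h(1) deg(1) kc deg(2) that] .
  have \<phi>_supp: "\<phi> z \<in> supp \<beta>" if "z \<in> supp \<beta>'" for z
  proof -
    have "z \<in> carrier G" "prj \<beta>' z \<noteq> 0" using that supp_closed by (auto simp: supp_def)
    then show ?thesis using prj' by (auto simp: supp_def)
  qed
  have comp: "\<exists>t\<in>S z. prj \<beta>' z = d * t * d" if z: "z \<in> carrier G" for z
  proof
    have \<phi>c: "\<phi> z \<in> carrier G" using z h kc by (simp add: \<phi>_def)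
    have "v * prj \<beta> (\<phi> z) * (q * v') \<in> S (h \<otimes> \<phi> z \<otimes> ?k)"
      using h q k yc \<phi>c by (intro S_mult) auto
    moreover have "h \<otimes> \<phi> z \<otimes> ?k = z"
    proof -
      have "h \<otimes> \<phi> z = z \<otimes> inv ?k"
        unfolding \<phi>_def using z h kc by (simp add: m_assoc[symmetric])
      then show ?thesis using z kc by (simp add: m_assoc)
    qed
    ultimately show "v * prj \<beta> (\<phi> z) * (q * v') \<in> S z" by simp
    show "prj \<beta>' z = d * (v * prj \<beta> (\<phi> z) * (q * v')) * d"
      using prj'[OF z] by (simp add: mult.assoc)
  qed
  have "form B H' \<beta>'"
    unfolding form_def
  proof (intro conjI ballI)
    show "subgroup H' G" by (rule H')
    show "\<beta>' \<in> B" 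
    proof -
      have "\<beta> \<in> B" using F by (simp add: form_def)
      then have "d * v * \<beta> \<in> B" using B by (simp add: ideal_of_def)
      then show ?thesis unfolding \<beta>'_def using B by (simp add: ideal_of_def)
    qed
    have "\<phi> (h \<otimes> y \<otimes> ?k) = y"
    proof -
      have "inv h \<otimes> (h \<otimes> y \<otimes> ?k) = y \<otimes> ?k" using h yc kc by (simp add: m_assoc[symmetric])
      then show ?thesis unfolding \<phi>_def using yc kc by (simp add: m_assoc)
    qed
    then have "prj \<beta>' (h \<otimes> y \<otimes> ?k) = d * v * d * v' * d"
      using prj'[of "h \<otimes> y \<otimes> ?k"] h yc kc by (simp add: d_def b_def mult.assoc)
    then show "\<beta>' \<noteq> 0" using k(3) by auto
    show "supp \<beta>' \<subseteq> H'"
    proof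
      fix z assume "z \<in> supp \<beta>'"
      then have z: "z \<in> carrier G" "prj \<beta>' z \<noteq> 0" using supp_closed by (auto simp: supp_def)
      then obtain t where "t \<in> S z" "d * t * d \<noteq> 0" using comp by metis
      then have "z \<in> linked d d" using z by (auto simp: linked_def)
      then show "z \<in> H'" using dd by blast
    qed
    fix z z' assume "z \<in> supp \<beta>'" "z' \<in> supp \<beta>'"
    then have "z \<in> carrier G" "z' \<in> carrier G" using supp_closed by auto
    then obtain t t' where t: "prj \<beta>' z = d * t * d" "prj \<beta>' z' = d * t' * d"
      using comp[of z] comp[of z'] by blast
    have "linked (d * t * d) (d * (t' * d)) \<subseteq> linked d d"
      using linked_mult_left[of "d * t" d "d * (t' * d)"] linked_mult_right[of d d "t' * d"]
      by (rule subset_trans)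
    also have "d * (t' * d) = d * t' * d" by (simp add: mult.assoc)
    finally show "linked (prj \<beta>' z) (prj \<beta>' z') \<subseteq> H'"
      unfolding t using dd by (rule subset_trans)
  qed
  moreover have "defect H' \<beta>' < defect H \<beta>"
  proof -
    let ?D = "{(y, y') \<in> supp \<beta> \<times> supp \<beta>. y' \<otimes> inv y \<notin> fin_conj H}"
    let ?D' = "{(z, z') \<in> supp \<beta>' \<times> supp \<beta>'. z' \<otimes> inv z \<notin> fin_conj H'}"
    let ?\<phi> = "\<lambda>(z, z'). (\<phi> z, \<phi> z')"
    have "finite ?D" by (rule finite_subset[of _ "supp \<beta> \<times> supp \<beta>"]) auto
    have \<phi>_inj: "z = z'" if "\<phi> z = \<phi> z'" "z \<in> carrier G" "z' \<in> carrier G" for z z'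
      using that h kc by (simp add: \<phi>_def)
    have inj: "inj_on ?\<phi> ?D'"
    proof (rule inj_onI)
      fix p p' assume p: "p \<in> ?D'" "p' \<in> ?D'" "?\<phi> p = ?\<phi> p'"
      then have "fst p \<in> carrier G" "snd p \<in> carrier G" "fst p' \<in> carrier G" "snd p' \<in> carrier G"
        using supp_closed[of \<beta>'] by auto
      then show "p = p'"
        using p(3) \<phi>_inj[of "fst p" "fst p'"] \<phi>_inj[of "snd p" "snd p'"]
        by (simp add: split_def prod_eq_iff)
    qed
    \<comment> \<open>Passing from \<open>z\<close> to \<open>\<phi> z\<close> conjugates quotients
      by \<open>inv h\<close>. Since \<open>h\<close> lies in \<open>H'\<close>, membership in
      \<open>fin_conj H'\<close> is unaffected, so counted pairs go to counted pairs.\<close>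
    have diff: "\<phi> z' \<otimes> inv (\<phi> z) = conjugate (inv h) (z' \<otimes> inv z)"
      if z: "z \<in> carrier G" "z' \<in> carrier G" for z z'
    proof -
      have "inv ?k \<otimes> (?k \<otimes> (inv z \<otimes> h)) = inv z \<otimes> h" using z h kc by (simp add: m_assoc[symmetric])
      moreover have "inv (\<phi> z) = ?k \<otimes> (inv z \<otimes> h)"
        unfolding \<phi>_def using z h kc by (simp add: inv_mult_group m_assoc)
      ultimately show ?thesis
        unfolding \<phi>_def conjugate_def using z h kc by (simp add: m_assoc)
    qed
    have notin: "\<phi> z' \<otimes> inv (\<phi> z) \<notin> fin_conj H'"
      if zz: "z \<in> carrier G" "z' \<in> carrier G" "z' \<otimes> inv z \<notin> fin_conj H'" for z z'
    proof
      assume "\<phi> z' \<otimes> inv (\<phi> z) \<in> fin_conj H'"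
      then have "conjugate h (conjugate (inv h) (z' \<otimes> inv z)) \<in> fin_conj H'"
        using fin_conj_conjugate[OF H'(1) hH'] diff zz by simp
      then show False using zz h by simp
    qed
    have w_fin: "w \<in> fin_conj H'" using H1(3) fin_conj_anti_mono[of H' H1] by (auto simp: H'_def)
    have anti: "fin_conj H \<subseteq> fin_conj H'" using fin_conj_anti_mono H' by blast
    have "w \<in> Q" using w by blast
    then obtain y1 y2 where y12: "y1 \<in> supp \<beta>" "y2 \<in> supp \<beta>" "w = y2 \<otimes> inv y1" "w \<notin> fin_conj H"
      unfolding Q by blast
    have "?\<phi> ` ?D' \<subseteq> ?D - {(y1, y2)}"
    proof
      fix p assume "p \<in> ?\<phi> ` ?D'"
      then obtain z z' where z: "z \<in> supp \<beta>'" "z' \<in> supp \<beta>'" "z' \<otimes> inv z \<notin> fin_conj H'"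
        "p = (\<phi> z, \<phi> z')" by auto
      then have "\<phi> z' \<otimes> inv (\<phi> z) \<notin> fin_conj H'" using notin supp_closed by blast
      then show "p \<in> ?D - {(y1, y2)}" using z \<phi>_supp anti w_fin y12 by auto
    qed
    moreover have "(y1, y2) \<in> ?D" using y12 by auto
    ultimately have "?\<phi> ` ?D' \<subset> ?D" by blast
    then have "card (?\<phi> ` ?D') < card ?D" using \<open>finite ?D\<close> psubset_card_mono by blast
    then show ?thesis unfolding defect_def using card_image[OF inj] by simp
  qed
  ultimately show thesis by (rule that)
qed

lemma minimal_form:
  assumes "b \<in> B" "b \<noteq> 0"
  obtains H \<beta> where "form B H \<beta>"
    "\<And>H' \<beta>'. form B H' \<beta>' \<Longrightarrow> defect H \<beta> \<le> defect H' \<beta>'"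
proof -
  define m where "m = (LEAST n. \<exists>H \<beta>. form B H \<beta> \<and> defect H \<beta> = n)"
  have "form B (carrier G) b"
    using assms supp_closed linked_closed subgroup_self by (auto simp: form_def)
  then have "\<exists>n H \<beta>. form B H \<beta> \<and> defect H \<beta> = n" by blast
  then obtain H \<beta> where "form B H \<beta>" "defect H \<beta> = m"
    unfolding m_def using LeastI_ex[of "\<lambda>n. \<exists>H \<beta>. form B H \<beta> \<and> defect H \<beta> = n"] by blast
  moreover have "m \<le> defect H' \<beta>'" if "form B H' \<beta>'" for H' \<beta>'
    unfolding m_def by (rule Least_le) (use that in blast)
  ultimately show thesis using that by blast
qed

section \<open>Leading terms\<close>

text \<open>For a form of minimal defect, \<open>linked a b\<close> is never small. Comparing leading terms of \<open>\<alpha> s \<beta> = 0\<close>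
  with respect to the ordered abelian group \<open>\<Delta>\<close> shows, however, that modulo small sets \<open>linked a' b\<close> misses
  the common centralizer of \<open>V\<close>, so that a minimal cover of \<open>linked a b\<close> by cosets of that centralizer
  could be shortened.\<close>

lemma torsion_free_ideal_product_nonzero:
  fixes A B :: "'r set"
  assumes tf: "torsion_free_group G" and A: "ideal_of A UNIV" and B: "ideal_of B UNIV"
    and \<alpha>0: "\<alpha>0 \<in> A" "\<alpha>0 \<noteq> 0" and b0: "b0 \<in> B" "b0 \<noteq> 0"
  shows "\<exists>a\<in>A. \<exists>b\<in>B. a * b \<noteq> 0"
proof (rule ccontr)
  assume "\<not> ?thesis"
  then have AB: "a * b = 0" if "a \<in> A" "b \<in> B" for a b using that by blast
  obtain H \<beta> where F: "form B H \<beta>"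
    and minimal: "\<And>H' \<beta>'. form B H' \<beta>' \<Longrightarrow> defect H \<beta> \<le> defect H' \<beta>'"
    using minimal_form[OF b0] by blast
  have H: "subgroup H G" and \<beta>: "\<beta> \<in> B" "\<beta> \<noteq> 0" and suppH: "supp \<beta> \<subseteq> H"
    and linkH: "\<And>y y'. y \<in> supp \<beta> \<Longrightarrow> y' \<in> supp \<beta> \<Longrightarrow> linked (prj \<beta> y) (prj \<beta> y') \<subseteq> H"
    using F by (auto simp: form_def)
  have Hc: "H \<subseteq> carrier G" using subgroup.subset[OF H] .
  have suppc: "supp \<beta> \<subseteq> carrier G" by (rule supp_closed)
  define \<Delta> where "\<Delta> = H \<inter> fin_conj H"
  have \<Delta>: "subgroup \<Delta> G" unfolding \<Delta>_def using subgroup_fin_conj[OF H] .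
  have \<Delta>c: "\<Delta> \<subseteq> carrier G" using subgroup.subset[OF \<Delta>] .
  have \<Delta>_comm: "x \<otimes> y = y \<otimes> x" if "x \<in> \<Delta>" "y \<in> \<Delta>" for x y
    using fin_conj_torsion_free_commute[OF tf H] that by (simp add: \<Delta>_def)
  obtain P where P: "P \<subseteq> \<Delta>" "\<one> \<in> P" "\<And>x y. x \<in> P \<Longrightarrow> y \<in> P \<Longrightarrow> x \<otimes> y \<in> P"
    "\<And>x. x \<in> P \<Longrightarrow> inv x \<in> P \<Longrightarrow> x = \<one>" "\<And>x. x \<in> \<Delta> \<Longrightarrow> x \<in> P \<or> inv x \<in> P"
    using subgroup_positive_cone[OF tf \<Delta> \<Delta>_comm] by metis
  have Pc: "P \<subseteq> carrier G" using P(1) \<Delta>c by blast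
  obtain y0 where y0: "y0 \<in> supp \<beta>" using \<beta>(2) supp_empty_iff by blast
  have y0c: "y0 \<in> carrier G" using y0 suppc by blast
  \<comment> \<open>The support of \<open>\<beta>\<close> need not meet \<open>\<Delta>\<close>;
    dividing by \<open>y0\<close> moves its part in the coset of \<open>y0\<close> into
    \<open>\<Delta>\<close>, where the order is total.\<close>
  define V where "V = {y \<otimes> inv y0 | y. y \<in> supp \<beta>} \<inter> fin_conj H"
  have V\<Delta>: "V \<subseteq> \<Delta>"
    using suppH y0 subgroup.m_closed[OF H] subgroup.m_inv_closed[OF H]
    unfolding V_def \<Delta>_def by blast
  have Vc: "V \<subseteq> carrier G" using V\<Delta> \<Delta>c by blast
  have "{y \<otimes> inv y0 | y. y \<in> supp \<beta>} = (\<lambda>y. y \<otimes> inv y0) ` supp \<beta>" by blast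
  then have finV: "finite V" by (simp add: V_def)
  have "y0 \<otimes> inv y0 = \<one>" using y0c by simp
  then have "\<one> \<in> V" using y0 fin_conj_one[OF Hc] unfolding V_def by force
  then have "V \<noteq> {}" by blast
  obtain v1 where v1: "v1 \<in> V" "\<And>v. v \<in> V \<Longrightarrow> inv v1 \<otimes> v \<in> P \<Longrightarrow> v = v1"
    using exists_maximal_for_cone[OF finV \<open>V \<noteq> {}\<close> Vc Pc P(3,4)] by blast
  have v1\<Delta>: "v1 \<in> \<Delta>" "v1 \<in> carrier G" using v1 V\<Delta> Vc by auto
  have v1_greatest: "inv v \<otimes> v1 \<in> P" if v: "v \<in> V" for v
  proof -
    have c: "v \<in> \<Delta>" "v \<in> carrier G" using v V\<Delta> Vc by auto
    have "inv v1 \<otimes> v \<in> \<Delta>"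
      using c v1\<Delta> subgroup.m_closed[OF \<Delta>] subgroup.m_inv_closed[OF \<Delta>] by blast
    then consider "inv v1 \<otimes> v \<in> P" | "inv (inv v1 \<otimes> v) \<in> P" using P(5) by blast
    then show ?thesis
    proof cases
      case 1
      then have "v = v1" using v1 v by blast
      then show ?thesis using c P(2) by simp
    next
      case 2
      then show ?thesis using c v1\<Delta> by (simp add: inv_mult_group)
    qed
  qed
  obtain y1 where y1: "y1 \<in> supp \<beta>" "v1 = y1 \<otimes> inv y0" using v1 by (auto simp: V_def)
  have y1c: "y1 \<in> carrier G" using y1 suppc by blast
  define b where "b = prj \<beta> y1"
  have b: "nzhom b" "b \<in> S y1" using nzhom_prj[OF y1(1)] y1c by (auto simp: b_def)
  define Q where "Q = {y2 \<otimes> inv y1 | y1 y2. y1 \<in> supp \<beta> \<and> y2 \<in> supp \<beta>} - fin_conj H"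
  have Qc: "Q \<subseteq> carrier G" using suppc by (auto simp: Q_def)
  have not_small: "\<not> small Q (linked a b)" if a: "nzhom a" for a
  proof
    assume sm: "small Q (linked a b)"
    \<comment> \<open>\<open>smaller_form\<close> speaks of right multiples of \<open>b\<close>; the
      unit \<open>e\<close> makes \<open>b\<close> itself one.\<close>
    obtain e where e: "e \<in> S \<one>" "b * e = b" using right_unit_one[OF y1c b(2)] .
    obtain H' \<beta>' where "form B H' \<beta>'" "defect H' \<beta>' < defect H \<beta>"
      using smaller_form[OF F B y1(1) Q_def a one_closed e(1)] e(2) b(1) sm by (auto simp: b_def)
    then show False using minimal by fastforce
  qed
  \<comment> \<open>\<open>\<rho> h\<close> records the left coset of \<open>h\<close> modulo the
    common centralizer of \<open>V\<close>. Restricting to \<open>V\<close> makes equality mean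
    agreement on \<open>V\<close>, so that \<open>PiE\<close> can bound the number of values on
    \<open>H\<close>.\<close>
  define \<rho> where "\<rho> h = restrict (\<lambda>v. conjugate h v) V" for h
  define cov where "cov a n \<longleftrightarrow> (\<exists>\<Psi>. finite \<Psi> \<and> card \<Psi> \<le> n \<and>
    small Q {h \<in> linked a b. \<rho> h \<notin> \<Psi>})" for a n
  have "\<exists>n a. nzhom a \<and> cov a n"
  proof -
    have "finite (PiE V (\<lambda>v. (\<lambda>h. conjugate h v) ` H))"
      by (rule finite_PiE[OF finV]) (auto simp: V_def fin_conj_def)
    moreover have "\<rho> ` H \<subseteq> PiE V (\<lambda>v. (\<lambda>h. conjugate h v) ` H)" by (auto simp: \<rho>_def)
    ultimately have "finite (\<rho> ` H)" by (rule rev_finite_subset)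
    moreover have "{h \<in> linked b b. \<rho> h \<notin> \<rho> ` H} = {}" using linkH[OF y1(1) y1(1)] by (auto simp: b_def)
    then have "small Q {h \<in> linked b b. \<rho> h \<notin> \<rho> ` H}" by (simp add: small_def) blast
    ultimately show ?thesis using b(1) unfolding cov_def by blast
  qed
  define n where "n = (LEAST n. \<exists>a. nzhom a \<and> cov a n)"
  have n_le: "n \<le> m" if "nzhom a" "cov a m" for a m
    unfolding n_def by (rule Least_le) (use that in blast)
  have "\<exists>a. nzhom a \<and> cov a n"
    unfolding n_def by (rule LeastI_ex[OF \<open>\<exists>n a. nzhom a \<and> cov a n\<close>])
  then obtain a \<Psi> where a: "nzhom a" and \<Psi>: "finite \<Psi>" "card \<Psi> \<le> n"
    "small Q {h \<in> linked a b. \<rho> h \<notin> \<Psi>}" unfolding cov_def by blast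
  have "\<exists>g\<in>linked a b. \<rho> g \<in> \<Psi>"
  proof (rule ccontr)
    assume "\<not> ?thesis"
    then have "{h \<in> linked a b. \<rho> h \<notin> \<Psi>} = linked a b" by blast
    then show False using \<Psi>(3) not_small[OF a] by simp
  qed
  then obtain g u where g: "g \<in> carrier G" "\<rho> g \<in> \<Psi>" and u: "u \<in> S g" "a * u * b \<noteq> 0"
    by (auto simp: linked_def)
  have "a * u \<noteq> 0" "u \<noteq> 0" using u(2) by auto
  then have au: "nzhom (a * u)" using nzhom_mult[OF a, of u] u g by (auto simp: nzhom_def)
  obtain x0 where x0: "x0 \<in> supp \<alpha>0" using \<alpha>0 supp_empty_iff by blast
  obtain j t where t: "j \<in> carrier G" "t \<in> S j" "prj \<alpha>0 x0 * t * (a * u) \<noteq> 0"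
    using linked_nonempty[OF nzhom_prj[OF x0] au] by (auto simp: linked_def)
  obtain r where r: "r \<in> carrier G" "a * u \<in> S r" using au by (auto simp: nzhom_def)
  \<comment> \<open>Every component of \<open>\<alpha>\<close> is a left multiple of
    \<open>a * u\<close>, so its links to \<open>b\<close>, translated by \<open>g\<close>, are
    links of \<open>a\<close> to \<open>b\<close>. The choice of \<open>t\<close> keeps
    \<open>\<alpha>\<close> nonzero.\<close>
  define \<alpha> where "\<alpha> = \<alpha>0 * (t * (a * u))"
  have \<alpha>A: "\<alpha> \<in> A" using A \<alpha>0 by (auto simp: \<alpha>_def ideal_of_def)
  have tau: "t * (a * u) \<in> S (j \<otimes> r)" using S_mult t r by blast
  have prj\<alpha>: "prj \<alpha> w = prj \<alpha>0 (w \<otimes> inv (j \<otimes> r)) * t * (a * u)" if "w \<in> carrier G" for w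
    unfolding \<alpha>_def using prj_mult_right[OF _ tau that] t r by (simp add: mult.assoc)
  have x0c: "x0 \<in> carrier G" using x0 supp_closed by blast
  have "x0 \<otimes> (j \<otimes> r) \<otimes> inv (j \<otimes> r) = x0" using x0c t r by (simp add: m_assoc)
  then have "prj \<alpha> (x0 \<otimes> (j \<otimes> r)) \<noteq> 0" using prj\<alpha>[of "x0 \<otimes> (j \<otimes> r)"] x0c t r by simp
  then have "supp \<alpha> \<noteq> {}" by (auto simp: supp_def)
  then obtain x1 where x1: "x1 \<in> supp \<alpha>" "\<And>x. x \<in> supp \<alpha> \<Longrightarrow> inv x1 \<otimes> x \<in> P \<Longrightarrow> x = x1"
    using exists_maximal_for_cone[OF finite_supp _ supp_closed Pc P(3,4), of \<alpha>] by blast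
  have x1c: "x1 \<in> carrier G" using x1 supp_closed by blast
  define a' where "a' = prj \<alpha> x1"
  have a': "nzhom a'" using nzhom_prj[OF x1(1)] by (simp add: a'_def)
  have link': "linked a' b \<subseteq> linked (a * u) b"
    unfolding a'_def prj\<alpha>[OF x1c] by (rule linked_mult_left)
  \<comment> \<open>The coset of \<open>g\<close> is dropped and the others are translated by
    \<open>inv g\<close>.\<close>
  define \<Psi>' where "\<Psi>' = (\<lambda>\<psi>. restrict (\<lambda>v. conjugate (inv g) (\<psi> v)) V) ` (\<Psi> - {\<rho> g})"
  have \<rho>_shift: "\<rho> h = restrict (\<lambda>v. conjugate (inv g) (\<rho> (g \<otimes> h) v)) V" if "h \<in> carrier G" for h
    unfolding \<rho>_def by (rule restrict_ext) (use that g Vc conjugate_shift in auto)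
  define Z0 where "Z0 = {inv x \<otimes> x' | x x'. x \<in> supp \<alpha> \<and> x' \<in> supp \<alpha>}"
  have "Z0 = (\<lambda>(x, x'). inv x \<otimes> x') ` (supp \<alpha> \<times> supp \<alpha>)" unfolding Z0_def by auto
  then have finZ0: "finite Z0" by simp
  \<comment> \<open>The assumption on \<open>\<rho>\<close> says that \<open>h\<close> centralizes
    \<open>V\<close>. If \<open>x\<close>, \<open>y\<close> give the same degree as
    \<open>x1\<close>, \<open>y1\<close>, then \<open>h\<close> conjugates
    \<open>y \<otimes> inv y1\<close> into \<open>inv x \<otimes> x1\<close>, an element of
    \<open>Z0\<close>. If that quotient lay in \<open>Q\<close>, the claim would hold. Otherwise it
    has the form \<open>v \<otimes> inv v1\<close> with \<open>v\<close> in \<open>V\<close>, so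
    \<open>h\<close> fixes it; as \<open>v1\<close> is greatest and \<open>x1\<close> is maximal,
    \<open>x = x1\<close> and \<open>y = y1\<close>.\<close>
  have key: "\<exists>w\<in>Q. conjugate h w \<in> Z0"
    if h: "h \<in> linked a' b" "\<rho> (g \<otimes> h) = \<rho> g" for h
  proof (rule ccontr)
    assume no: "\<not> ?thesis"
    have hc: "h \<in> carrier G" using h linked_closed by blast
    obtain s where s: "s \<in> S h" "a' * s * b \<noteq> 0" using h by (auto simp: linked_def)
    have fix_V: "conjugate h v = v" if v: "v \<in> V" for v
    proof -
      have vc: "v \<in> carrier G" using v Vc by blast
      have "\<rho> (g \<otimes> h) v = \<rho> g v" using h(2) by simp
      then have "conjugate g (conjugate h v) = conjugate g v"
        using v vc hc g by (simp add: \<rho>_def conjugate_conjugate)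
      then show ?thesis using conjugate_inj[OF _ g(1)] vc hc by simp
    qed
    have "\<alpha> * s \<in> A" using A \<alpha>A by (simp add: ideal_of_def)
    then have zero: "\<alpha> * s * \<beta> = 0" using AB \<beta>(1) by blast
    have "prj \<alpha> x1 * s * prj \<beta> y1 = 0"
    proof (rule homogeneous_zero_if_isolated[OF zero hc s(1) x1(1) y1(1)])
      fix x y assume x: "x \<in> supp \<alpha>" and y: "y \<in> supp \<beta>" and eq: "x \<otimes> h \<otimes> y = x1 \<otimes> h \<otimes> y1"
      have c: "x \<in> carrier G" "y \<in> carrier G" using x y supp_closed by auto
      let ?d = "y \<otimes> inv y1"
      have conj_eq: "conjugate h ?d = inv x \<otimes> x1"
      proof -
        have "inv x \<otimes> (x \<otimes> h \<otimes> y) = h \<otimes> y" using c hc by (simp add: m_assoc[symmetric])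
        then have "h \<otimes> y = inv x \<otimes> (x1 \<otimes> h \<otimes> y1)" using eq by simp
        then have "h \<otimes> ?d \<otimes> inv h = inv x \<otimes> (x1 \<otimes> h \<otimes> y1) \<otimes> inv y1 \<otimes> inv h"
          using c hc y1c by (simp add: m_assoc[symmetric])
        also have "\<dots> = inv x \<otimes> x1"
          using c hc y1c x1c by (simp add: m_assoc)
        finally show ?thesis by (simp add: conjugate_def)
      qed
      then have "conjugate h ?d \<in> Z0" using x x1(1) unfolding Z0_def by blast
      then have "?d \<notin> Q" using no by blast
      then have d_fin: "?d \<in> fin_conj H" using y y1 unfolding Q_def by blast
      define v where "v = y \<otimes> inv y0"
      have vc: "v \<in> carrier G" using c y0c by (simp add: v_def)
      have d_eq: "?d = v \<otimes> inv v1"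
      proof -
        have "inv y0 \<otimes> (y0 \<otimes> inv y1) = inv y1" using y0c y1c by (simp add: m_assoc[symmetric])
        then show ?thesis unfolding v_def y1(2) using c y0c y1c by (simp add: inv_mult_group m_assoc)
      qed
      have "v = ?d \<otimes> v1" unfolding d_eq using vc v1\<Delta> by (simp add: m_assoc)
      then have "v \<in> fin_conj H" using fin_conj_mult[OF Hc d_fin] v1 by (auto simp: V_def)
      then have vV: "v \<in> V" using y unfolding V_def v_def by blast
      have v\<Delta>: "v \<in> \<Delta>" using vV V\<Delta> by blast
      have "conjugate h ?d = ?d"
        unfolding d_eq using fix_V[OF vV] fix_V[OF v1(1)] hc vc v1\<Delta>
        by (simp add: conjugate_mult conjugate_inv)
      then have eq': "inv x \<otimes> x1 = v \<otimes> inv v1" using conj_eq d_eq by simp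
      then have "inv (inv x \<otimes> x1) = inv (v \<otimes> inv v1)" by simp
      then have "inv x1 \<otimes> x = v1 \<otimes> inv v" using c x1c vc v1\<Delta> by (simp add: inv_mult_group)
      also have "\<dots> = inv v \<otimes> v1" using \<Delta>_comm v1\<Delta> v\<Delta> subgroup.m_inv_closed[OF \<Delta>] by blast
      finally have "inv x1 \<otimes> x \<in> P" using v1_greatest[OF vV] by simp
      then have "x = x1" using x1(2) x by blast
      then have "h \<otimes> y = h \<otimes> y1" using eq c hc y1c by (simp add: m_assoc)
      then show "x = x1 \<and> y = y1" using \<open>x = x1\<close> c hc y1c by simp
    qed
    then show False using s(2) by (simp add: a'_def b_def)
  qed
  have "small Q {h \<in> linked a' b. \<rho> h \<notin> \<Psi>'}"
  proof (rule small_mono[OF small_Un[OF small_shift[OF \<Psi>(3) Qc g(1)]]])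
    show "small Q {h \<in> linked a' b. \<rho> (g \<otimes> h) = \<rho> g}"
      unfolding small_def using key finZ0 by blast
    show "{h \<in> linked a' b. \<rho> h \<notin> \<Psi>'} \<subseteq>
        {h \<in> carrier G. g \<otimes> h \<in> {h \<in> linked a b. \<rho> h \<notin> \<Psi>}} \<union>
        {h \<in> linked a' b. \<rho> (g \<otimes> h) = \<rho> g}"
    proof
      fix h assume h: "h \<in> {h \<in> linked a' b. \<rho> h \<notin> \<Psi>'}"
      then have hc: "h \<in> carrier G" using linked_closed by blast
      have "g \<otimes> h \<in> linked a b" using linked_shift_left[OF _ g(1) u(1)] h link' by blast
      moreover have "\<rho> (g \<otimes> h) \<notin> \<Psi> - {\<rho> g}"
      proof
        assume "\<rho> (g \<otimes> h) \<in> \<Psi> - {\<rho> g}"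
        then have "\<rho> h \<in> \<Psi>'" unfolding \<Psi>'_def using \<rho>_shift[OF hc] by (intro image_eqI)
        then show False using h by blast
      qed
      ultimately show "h \<in> {h \<in> carrier G. g \<otimes> h \<in> {h \<in> linked a b. \<rho> h \<notin> \<Psi>}} \<union>
        {h \<in> linked a' b. \<rho> (g \<otimes> h) = \<rho> g}" using h hc by blast
    qed
  qed
  moreover have "finite \<Psi>'" using \<Psi>(1) by (simp add: \<Psi>'_def)
  ultimately have "cov a' (card \<Psi>')" unfolding cov_def by (intro exI[of _ \<Psi>']) simp
  then have "n \<le> card \<Psi>'" using n_le a' by blast
  also have "\<dots> \<le> card (\<Psi> - {\<rho> g})" unfolding \<Psi>'_def using \<Psi>(1) by (intro card_image_le) auto
  also have "\<dots> < card \<Psi>" using card_Diff1_less[OF \<Psi>(1) g(2)] .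
  finally show False using \<Psi>(2) by simp
qed

end

theorem theorem1p4:
  fixes G :: "('g, 'm) monoid_scheme"
    and S :: "'g \<Rightarrow> 'a::ring set"
  assumes "torsion_free_group G"
    and "(UNIV :: 'a set) \<noteq> {0}"
    and "nearly_epsilon_strongly_graded G S"
  shows "prime_ring (UNIV :: 'a set) \<longleftrightarrow> G_prime G S"
proof -
  interpret group G using assms(1) by (simp add: torsion_free_group_def)
  interpret nearly_graded G S using assms(3) by unfold_locales
  show ?thesis
  proof
    show "G_prime G S" if "prime_ring (UNIV :: 'a set)"
      using prime_imp_G_prime assms(2) that by blast
  next
    assume "G_prime G S"
    then interpret G_prime_graded G S by unfold_locales
    show "prime_ring (UNIV :: 'a set)"
      unfolding prime_ring_def
    proof (intro conjI allI impI)
      show "proper_ideal_of {0} (UNIV :: 'a set)"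
        using zero_ideal assms(2) by (auto simp: proper_ideal_of_def)
    next
      fix A B :: "'a set"
      assume AB: "ideal_of A UNIV \<and> ideal_of B UNIV \<and> prod_sums A B = {0}"
      then have "0 \<in> A" "0 \<in> B" by (auto simp: ideal_of_def add_subgroup_def)
      moreover have "a = 0 \<or> b = 0" if "a \<in> A" "b \<in> B" for a b
        using torsion_free_ideal_product_nonzero[OF assms(1)] AB that prod_sumsI by blast
      ultimately show "A = {0} \<or> B = {0}" by blast
    qed
  qed
qed

end
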